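(* Every $n$-vertex stacked triangulation with $n \geq 4$ has an edge guard set of size at most $\lfloor 2n/7 \rfloor$.
   Context: A plane graph is a simple graph together with a crossing-free embedding in $\mathbb{R}^2$. Stacked triangulations are defined recursively: (i) a triangle (a plane $3$-cycle) is a stacked triangulation; (ii) if $G$ is a stacked triangulation and $f=(x,y,z)$ is an inner face, then the plane graph obtained by placing a new vertex $v$ inside $f$ and joining it to $x,y,z$ is a stacked triangulation. For a plane graph $G=(V,E)$, a face $f$ is guarded by an edge $vw \in E$ if at least one of $v,w$ lies on the boundary of $f$. A set $\Gamma \subseteq E$ is an edge guard set if every face of $G$ (including the outer face) is guarded by some edge of $\Gamma$. *)

theory Defs
  imports "HOL-Analysis.Analysis"
begin

text \<open>The plane \<open>\<real>\<^sup>2\<close> is the type \<^typ>\<open>complex\<close>, on which the Jordan curve theorem is stated.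
  Edges are two-element vertex sets; the embedding sends vertices to points and edges to arcs.
  The values of \<open>point\<close> and \<open>curve\<close> outside \<open>verts\<close> and \<open>edges\<close> are irrelevant.\<close>

record 'v drawn_graph =
  verts :: "'v set"
  edges :: "'v set set"
  point :: "'v \<Rightarrow> complex"
  curve :: "'v set \<Rightarrow> real \<Rightarrow> complex"

definition simple_graph :: "'v drawn_graph \<Rightarrow> bool" where
  "simple_graph G \<longleftrightarrow> finite (verts G) \<and> (\<forall>e\<in>edges G. e \<subseteq> verts G \<and> card e = 2)"

definition crossing_free_embedding :: "'v drawn_graph \<Rightarrow> bool" where
  "crossing_free_embedding G \<longleftrightarrow>
     inj_on (point G) (verts G) \<and>
     (\<forall>e\<in>edges G. arc (curve G e) \<and>
        {pathstart (curve G e), pathfinish (curve G e)} = point G ` e) \<and>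
     (\<forall>e\<in>edges G. \<forall>v\<in>verts G. point G v \<in> path_image (curve G e) \<longrightarrow> v \<in> e) \<and>
     (\<forall>e\<in>edges G. \<forall>e'\<in>edges G. e \<noteq> e' \<longrightarrow>
        path_image (curve G e) \<inter> path_image (curve G e') \<subseteq> point G ` (e \<inter> e'))"

definition plane_graph :: "'v drawn_graph \<Rightarrow> bool" where
  "plane_graph G \<longleftrightarrow> simple_graph G \<and> crossing_free_embedding G"

definition drawing :: "'v drawn_graph \<Rightarrow> complex set" where
  "drawing G = point G ` verts G \<union> (\<Union>e\<in>edges G. path_image (curve G e))"

definition faces :: "'v drawn_graph \<Rightarrow> complex set set" where
  "faces G = components (- drawing G)"

definition inner_faces :: "'v drawn_graph \<Rightarrow> complex set set" where
  "inner_faces G = {f \<in> faces G. bounded f}"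

definition bounded_by_triangle ::
    "'v drawn_graph \<Rightarrow> complex set \<Rightarrow> 'v \<Rightarrow> 'v \<Rightarrow> 'v \<Rightarrow> bool" where
  "bounded_by_triangle G f x y z \<longleftrightarrow>
     distinct [x, y, z] \<and> {{x, y}, {y, z}, {x, z}} \<subseteq> edges G \<and>
     frontier f = path_image (curve G {x, y}) \<union> path_image (curve G {y, z}) \<union>
                  path_image (curve G {x, z})"

text \<open>In the rule \<open>stack\<close>, the three new arcs run inside \<open>f\<close> up to their endpoints on the boundary:
  they contain a point of \<open>f\<close>, and \<open>H\<close> being plane, they cannot cross the drawing of \<open>G\<close>.\<close>

inductive stacked_triangulation :: "'v drawn_graph \<Rightarrow> bool" where
  triangle: "stacked_triangulation G"
    if "plane_graph G"
      and "distinct [x, y, z]"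
      and "verts G = {x, y, z}"
      and "edges G = {{x, y}, {y, z}, {x, z}}"
| stack: "stacked_triangulation H"
    if "stacked_triangulation G"
      and "f \<in> inner_faces G"
      and "bounded_by_triangle G f x y z"
      and "v \<notin> verts G"
      and "plane_graph H"
      and "verts H = insert v (verts G)"
      and "edges H = edges G \<union> {{v, x}, {v, y}, {v, z}}"
      and "\<forall>u\<in>verts G. point H u = point G u"
      and "\<forall>e\<in>edges G. curve H e = curve G e"
      and "point H v \<in> f"

definition guards :: "'v drawn_graph \<Rightarrow> 'v set \<Rightarrow> complex set \<Rightarrow> bool" where
  "guards G e f \<longleftrightarrow> (\<exists>v\<in>e. point G v \<in> frontier f)"

definition edge_guard_set :: "'v drawn_graph \<Rightarrow> 'v set set \<Rightarrow> bool" where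
  "edge_guard_set G \<Gamma> \<longleftrightarrow> \<Gamma> \<subseteq> edges G \<and> (\<forall>f\<in>faces G. \<exists>e\<in>\<Gamma>. guards G e f)"

end

theory Submission
  imports Defs
begin

text \<open>A stacked triangulation is a triangle refined along a ternary tree, whose leaves are the inner
  faces. Call a subtree inside a triangle \<open>K\<close> of type \<open>(i, j)\<close>, where \<open>i \<le> 3\<close>, if guarding the faces
  inside \<open>K\<close> is at most as expensive as guarding a hardest subtree with \<open>i\<close> vertices and \<open>j\<close> further
  edges. By induction over the tree, a subtree with \<open>m\<close> vertices has a type \<open>(i, j)\<close> with
  \<open>2 i + 7 j \<le> 2 m\<close>. The induction step amounts to one finite case distinction on the types of the
  three children, as the values of \<open>j\<close> just add up. Finally the outer face costs one edge more than
  \<open>j\<close>, which is within the bound except if \<open>i = 0\<close> and \<open>7 j = 2 m\<close>; then the outer face can be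
  guarded for free.

  The faces of the drawing are identified with the leaves by the Jordan curve theorem and its
  extension to theta curves: each stacking step replaces the inside of a triangle by the insides
  of three triangles.\<close>

text \<open>A vertex is worth 2 and an edge costs 7. The obstacle is that the cost of a subtree is
  not a single number: it depends on which corners of \<open>K\<close> are covered from outside, and
  the edges spent inside may in turn cover corners that neighbouring subtrees need. A type records
  just enough of this exchange. Four values of \<open>i\<close> suffice because a subtree with
  \<open>i = 3\<close> spends an edge of its own, and a node over three of these has type 3 again
  with \<open>j\<close> raised by two: 2 * 9 + 2 = 2 * 3 + 7 * 2, without any loss. The three outer
  vertices contribute only 6, one less than an edge for the outer face. So one unit of slack must be
  found elsewhere, and among the nodes that yield \<open>i = 0\<close> it is missing exactly for
  children with the values 3, 2, 1 or 3, 3, 0.\<close>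

section \<open>Guarding sets of triangles\<close>

text \<open>\<open>guardable E F N P k\<close>: when the vertices in \<open>N\<close> are already covered by guards, \<open>k\<close> more edges
  suffice to guard the faces \<open>F\<close> and also to cover \<open>P\<close>.\<close>

definition guardable :: "'v set set \<Rightarrow> 'v set set \<Rightarrow> 'v set \<Rightarrow> 'v set \<Rightarrow> nat \<Rightarrow> bool" where
  "guardable E F N P k \<longleftrightarrow>
     (\<exists>\<Gamma>\<subseteq>E. finite \<Gamma> \<and> card \<Gamma> \<le> k \<and> P \<subseteq> N \<union> \<Union>\<Gamma> \<and> (\<forall>f\<in>F. f \<inter> (N \<union> \<Union>\<Gamma>) \<noteq> {}))"

lemma guardableI:
  assumes "\<Gamma> \<subseteq> E" "finite \<Gamma>" "card \<Gamma> \<le> k" "P \<subseteq> N \<union> \<Union>\<Gamma>" "\<And>f. f \<in> F \<Longrightarrow> f \<inter> (N \<union> \<Union>\<Gamma>) \<noteq> {}"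
  shows "guardable E F N P k"
  unfolding guardable_def by (intro exI[of _ \<Gamma>] conjI ballI) (fact assms)+

lemma guardableE:
  assumes "guardable E F N P k"
  obtains \<Gamma> where "\<Gamma> \<subseteq> E" "finite \<Gamma>" "card \<Gamma> \<le> k" "P \<subseteq> N \<union> \<Union>\<Gamma>"
    "\<forall>f\<in>F. f \<inter> (N \<union> \<Union>\<Gamma>) \<noteq> {}"
  using assms unfolding guardable_def by (elim exE conjE) (rule that)

lemma guardable_mono:
  assumes "guardable E F N P k" "N \<subseteq> N'" "P' \<subseteq> N' \<union> P" "k \<le> k'"
  shows "guardable E F N' P' k'"
proof -
  obtain \<Gamma> where G: "\<Gamma> \<subseteq> E" "finite \<Gamma>" "card \<Gamma> \<le> k" "P \<subseteq> N \<union> \<Union>\<Gamma>"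
    "\<forall>f\<in>F. f \<inter> (N \<union> \<Union>\<Gamma>) \<noteq> {}"
    using assms(1) by (rule guardableE)
  have sub: "N \<union> \<Union>\<Gamma> \<subseteq> N' \<union> \<Union>\<Gamma>" using assms(2) by auto
  show ?thesis
  proof (rule guardableI[OF G(1,2)])
    show "card \<Gamma> \<le> k'" using G(3) assms(4) by simp
    show "P' \<subseteq> N' \<union> \<Union>\<Gamma>" using G(4) sub assms(3) by auto
    show "f \<inter> (N' \<union> \<Union>\<Gamma>) \<noteq> {}" if "f \<in> F" for f
      using bspec[OF G(5) that] Int_mono[OF order_refl sub, of f] by (metis subset_empty)
  qed
qed

text \<open>Sequential composition: corners covered while guarding one family are at the disposal of
  the next. The order of the families matters, and the proofs about wheels choose it.\<close>

lemma guardable_Un: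
  assumes "guardable E F\<^sub>1 N M a" "guardable E F\<^sub>2 (N \<union> M) P b"
  shows "guardable E (F\<^sub>1 \<union> F\<^sub>2) N (M \<union> P) (a + b)"
proof -
  obtain \<Gamma> where G: "\<Gamma> \<subseteq> E" "finite \<Gamma>" "card \<Gamma> \<le> a" "M \<subseteq> N \<union> \<Union>\<Gamma>"
      "\<forall>f\<in>F\<^sub>1. f \<inter> (N \<union> \<Union>\<Gamma>) \<noteq> {}"
    using assms(1) by (rule guardableE)
  obtain \<Delta> where D: "\<Delta> \<subseteq> E" "finite \<Delta>" "card \<Delta> \<le> b" "P \<subseteq> (N \<union> M) \<union> \<Union>\<Delta>"
      "\<forall>f\<in>F\<^sub>2. f \<inter> ((N \<union> M) \<union> \<Union>\<Delta>) \<noteq> {}"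
    using assms(2) by (rule guardableE)
  have sub: "N \<union> \<Union>\<Gamma> \<subseteq> N \<union> \<Union>(\<Gamma> \<union> \<Delta>)" "(N \<union> M) \<union> \<Union>\<Delta> \<subseteq> N \<union> \<Union>(\<Gamma> \<union> \<Delta>)"
    using G(4) by auto
  show ?thesis
  proof (rule guardableI[of "\<Gamma> \<union> \<Delta>"])
    show "card (\<Gamma> \<union> \<Delta>) \<le> a + b"
      using card_Un_le[of \<Gamma> \<Delta>] G(3) D(3) by linarith
    show "M \<union> P \<subseteq> N \<union> \<Union>(\<Gamma> \<union> \<Delta>)"
      using G(4) D(4) sub by (meson Un_least order_trans)
    show "f \<inter> (N \<union> \<Union>(\<Gamma> \<union> \<Delta>)) \<noteq> {}" if "f \<in> F\<^sub>1 \<union> F\<^sub>2" for f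
      using that bspec[OF G(5), of f] bspec[OF D(5), of f] Int_mono[OF order_refl sub(1), of f]
        Int_mono[OF order_refl sub(2), of f] by (metis UnE subset_empty)
  qed (use G(1,2) D(1,2) in simp_all)
qed

lemma guardable_edge:
  assumes "e \<in> E" "guardable E F (N \<union> e) P k"
  shows "guardable E F N (e \<union> P) (Suc k)"
proof -
  have "guardable E {} N e 1"
    by (rule guardableI[of "{e}"]) (use assms(1) in auto)
  from guardable_Un[OF this assms(2)] show ?thesis by simp
qed

lemma guardable_Un3:
  assumes "guardable E A N M a" "guardable E B (N \<union> M) P b" "guardable E C (N \<union> M \<union> P) Q c"
  shows "guardable E (A \<union> B \<union> C) N (M \<union> P \<union> Q) (a + b + c)"
  using guardable_Un[OF guardable_Un[OF assms(1,2)], of C Q c] assms(3)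
  by (simp add: Un_assoc)

text \<open>The conditions express what a guard set of a hardest subtree with \<open>i\<close> vertices can be turned
  into. A leaf forces a covered corner, one vertex forces any two covered corners, and two vertices
  can force two specific ones. The hardest subtree with three vertices always uses up an edge; this
  edge can cover the apex \<open>p\<close>, and any corner of choice once \<open>p\<close> is covered.\<close>

definition gtype :: "'v set set \<Rightarrow> 'v set set \<Rightarrow> 'v set \<Rightarrow> nat \<Rightarrow> nat \<Rightarrow> bool" where
  "gtype E F K i j \<longleftrightarrow>
     (if i = 0 then \<forall>a\<in>K. guardable E F {a} {} j
      else if i = 1 then \<forall>a\<in>K. \<forall>b\<in>K. a \<noteq> b \<longrightarrow> guardable E F {a, b} {} j
      else if i = 2 then \<exists>a\<in>K. \<exists>b\<in>K. a \<noteq> b \<and> guardable E F {a, b} {} j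
      else \<exists>p\<in>K. guardable E F {} {p} (Suc j) \<and> (\<forall>a\<in>K. guardable E F {p} {a} (Suc j)))"

lemma gtype_0D: "gtype E F K 0 j \<Longrightarrow> a \<in> K \<Longrightarrow> a \<in> N \<Longrightarrow> guardable E F N {} j"
  unfolding gtype_def by (auto intro: guardable_mono)

lemma gtype_1D:
  "gtype E F K (Suc 0) j \<Longrightarrow> a \<in> K \<Longrightarrow> b \<in> K \<Longrightarrow> a \<noteq> b \<Longrightarrow> a \<in> N \<Longrightarrow> b \<in> N \<Longrightarrow> guardable E F N {} j"
  unfolding gtype_def by (auto intro: guardable_mono[of E F "{a, b}"])

lemma gtype_2E:
  assumes "gtype E F K 2 j"
  obtains a b where "a \<in> K" "b \<in> K" "a \<noteq> b" "guardable E F {a, b} {} j"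
proof -
  have "\<exists>a\<in>K. \<exists>b\<in>K. a \<noteq> b \<and> guardable E F {a, b} {} j"
    using assms unfolding gtype_def by simp
  then show ?thesis by (elim bexE conjE) (rule that)
qed

lemma guardable_pair:
  "guardable E F {a, b} {} j \<Longrightarrow> a \<in> N \<Longrightarrow> b \<in> N \<Longrightarrow> guardable E F N {} j"
  by (erule guardable_mono) auto

text \<open>The last case of \<open>gtype\<close> with its witness named, so that the position of
  \<open>p\<close> can be distinguished.\<close>

definition apex :: "'v set set \<Rightarrow> 'v set set \<Rightarrow> 'v set \<Rightarrow> nat \<Rightarrow> 'v \<Rightarrow> bool" where
  "apex E F K j p \<longleftrightarrow>
     p \<in> K \<and> guardable E F {} {p} (Suc j) \<and> (\<forall>a\<in>K. guardable E F {p} {a} (Suc j))"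

lemma gtype_3E:
  assumes "gtype E F K 3 j"
  obtains p where "apex E F K j p"
proof -
  have "\<exists>p\<in>K. guardable E F {} {p} (Suc j) \<and> (\<forall>a\<in>K. guardable E F {p} {a} (Suc j))"
    using assms unfolding gtype_def by simp
  then show ?thesis using that unfolding apex_def by (elim bexE) simp
qed

lemma apexD:
  assumes "apex E F K j p"
  shows "p \<in> K" "guardable E F N {p} (Suc j)"
    "p \<in> N \<Longrightarrow> a \<in> K \<Longrightarrow> guardable E F N {a} (Suc j)"
proof -
  show "p \<in> K" using assms unfolding apex_def by simp
  have "guardable E F {} {p} (Suc j)" using assms unfolding apex_def by simp
  then show "guardable E F N {p} (Suc j)" by (rule guardable_mono) auto
  assume "p \<in> N" "a \<in> K"
  then have "guardable E F {p} {a} (Suc j)" using assms unfolding apex_def by simp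
  then show "guardable E F N {a} (Suc j)" by (rule guardable_mono) (use \<open>p \<in> N\<close> in auto)
qed

text \<open>With one corner covered, the edge spent in \<open>K\<close> yields a second one, though
  not one of choice: if \<open>p = u\<close>, any corner can be covered, and otherwise covering
  \<open>p\<close> itself is the gain.\<close>

lemma apex_gain:
  assumes "apex E F K j p" "K = {u, w, t}" "u \<in> N"
  shows "guardable E F N {w} (Suc j) \<or> guardable E F N {t} (Suc j)"
proof (cases "p = u")
  case True
  have "guardable E F N {w} (Suc j)"
    by (rule apexD(3)[OF assms(1)]) (use assms True in simp_all)
  then show ?thesis ..
next
  case False
  then have "p = w \<or> p = t" using apexD(1)[OF assms(1)] assms(2) by simp
  then show ?thesis using apexD(2)[OF assms(1), of N] by (elim disjE) simp_all
qed

definition triangle_in :: "'v set set \<Rightarrow> 'v set \<Rightarrow> bool" where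
  "triangle_in E K \<longleftrightarrow> card K = 3 \<and> (\<forall>a\<in>K. \<forall>b\<in>K. a \<noteq> b \<longrightarrow> {a, b} \<in> E)"

lemma triangle_inE:
  assumes "triangle_in E K" "a \<in> K" "b \<in> K" "a \<noteq> b"
  obtains c where "K = {a, b, c}" "c \<noteq> a" "c \<noteq> b" "{a, b} \<in> E" "{a, c} \<in> E" "{b, c} \<in> E"
proof -
  have "finite K" using assms(1) unfolding triangle_in_def by (metis card.infinite zero_neq_numeral)
  then have "card (K - {a, b}) = 1"
    using assms unfolding triangle_in_def by (simp add: card_Diff_subset)
  then obtain c where c: "K - {a, b} = {c}" by (rule card_1_singletonE)
  then have "K = {a, b, c}" "c \<noteq> a" "c \<noteq> b" using assms by auto
  with assms that[of c] show ?thesis unfolding triangle_in_def by simp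
qed

text \<open>A larger \<open>i\<close> is a weaker demand. From 2 to 3, the additional edge is chosen
  to complete the pair \<open>a\<close>, \<open>b\<close>, with \<open>a\<close> as the apex: the
  edge \<open>ab\<close> serves at first, and once \<open>a\<close> is covered, \<open>bc\<close>
  reaches the third corner too.\<close>

lemma gtype_Suc:
  assumes "triangle_in E K" "gtype E F K i j" "i < 3"
  shows "gtype E F K (Suc i) j"
proof -
  consider "i = 0" | "i = 1" | "i = 2" using assms(3) by linarith
  then show ?thesis
  proof cases
    case 1
    then show ?thesis using assms(2) unfolding gtype_def by (auto intro: guardable_mono)
  next
    case 2
    obtain a b where "a \<in> K" "b \<in> K" "a \<noteq> b"
      using assms(1) unfolding triangle_in_def by (metis card_3_iff insertCI)
    then show ?thesis using 2 assms(2) unfolding gtype_def by auto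
  next
    case 3
    obtain a b where ab: "a \<in> K" "b \<in> K" "a \<noteq> b" and "guardable E F {a, b} {} j"
      using assms(2) unfolding 3 by (rule gtype_2E)
    note g = guardable_pair[OF this(4)]
    obtain c where c: "K = {a, b, c}" "{a, b} \<in> E" "{b, c} \<in> E"
      using triangle_inE[OF assms(1) ab] by metis
    have "guardable E F N {a} (Suc j)" "guardable E F N {b} (Suc j)" for N
      using guardable_edge[OF c(2) g, of N] by (auto intro: guardable_mono)
    moreover have "guardable E F {a} {c} (Suc j)"
      using guardable_edge[OF c(3) g, of "{a}"] by (auto intro: guardable_mono)
    ultimately show ?thesis
      using 3 c(1) unfolding gtype_def by (auto simp: insert_commute)
  qed
qed

lemma gtype_mono:
  assumes "triangle_in E K" "gtype E F K i j" "i \<le> i'" "i' \<le> 3"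
  shows "gtype E F K i' j"
  using assms(3,4)
proof (induction i' rule: dec_induct)
  case base
  show ?case by (fact assms(2))
next
  case (step n)
  then show ?case using gtype_Suc[OF assms(1), of F n j] by simp
qed

lemma guardable_edge_Un3:
  assumes "e \<in> E" "guardable E A (N \<union> e) {} a" "guardable E B (N \<union> e) {} b" "guardable E C (N \<union> e) {} c"
  shows "guardable E (A \<union> B \<union> C) N e (Suc (a + b + c))"
  using guardable_edge[OF assms(1) guardable_Un3[of E A "N \<union> e" "{}" a B "{}" b C "{}" c]] assms(2-4)
  by simp

lemma guardable_Un_edge_Un:
  assumes "guardable E A N M a" "e \<in> E" "guardable E B (N \<union> M \<union> e) {} b"
    "guardable E C (N \<union> M \<union> e) {} c"
  shows "guardable E (A \<union> B \<union> C) N (M \<union> e) (Suc (a + b + c))"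
proof -
  have "guardable E (B \<union> C) (N \<union> M) e (Suc (b + c))"
    using guardable_edge[OF assms(2) guardable_Un[of E B _ "{}" b C "{}" c]] assms(3,4) by simp
  from guardable_Un[OF assms(1) this] show ?thesis by (simp add: Un_assoc add.assoc)
qed

section \<open>The type of a subtree from the types of its children\<close>

text \<open>The triangle \<open>xyz\<close> with the center \<open>v\<close>; the three parts \<open>A\<close>, \<open>B\<close>, \<open>C\<close> lie opposite to
  \<open>x\<close>, \<open>y\<close>, \<open>z\<close>. The digits in the names of the following lemmas are the values \<open>i\<close> of the three
  parts; the remaining cases follow by monotonicity and symmetry.\<close>

locale wheel =
  fixes E :: "'v set set" and v x y z :: 'v and A B C :: "'v set set"
  assumes dist: "distinct [v, x, y, z]"
    and spokes: "{v, x} \<in> E" "{v, y} \<in> E" "{v, z} \<in> E"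
    and rim: "{x, y} \<in> E" "{y, z} \<in> E" "{x, z} \<in> E"
begin

lemma edges: "a \<in> {v, x, y, z} \<Longrightarrow> b \<in> {v, x, y, z} \<Longrightarrow> a \<noteq> b \<Longrightarrow> {a, b} \<in> E"
  using spokes rim by (auto simp: insert_commute)

lemma triangles: "triangle_in E {v, y, z}" "triangle_in E {x, v, z}" "triangle_in E {x, y, v}"
  "triangle_in E {x, y, z}"
  using dist edges unfolding triangle_in_def by auto

abbreviation "ABC \<equiv> A \<union> B \<union> C"

text \<open>Each part misses only one corner of \<open>xyz\<close>, so any two corners meet all
  three parts.\<close>

lemma gtype_000:
  assumes "gtype E A {v, y, z} 0 a" "gtype E B {x, v, z} 0 b" "gtype E C {x, y, v} 0 c"
  shows "gtype E ABC {x, y, z} 1 (a + b + c)"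
proof -
  have "guardable E ABC {u, w} {} (a + b + c)" if "u \<in> {x, y, z}" "w \<in> {x, y, z}" "u \<noteq> w" for u w
  proof -
    have "guardable E A {u, w} {} a"
      using gtype_0D[OF assms(1), of y "{u, w}"] gtype_0D[OF assms(1), of z "{u, w}"] that by auto
    moreover have "guardable E B {u, w} {} b"
      using gtype_0D[OF assms(2), of x "{u, w}"] gtype_0D[OF assms(2), of z "{u, w}"] that by auto
    moreover have "guardable E C {u, w} {} c"
      using gtype_0D[OF assms(3), of x "{u, w}"] gtype_0D[OF assms(3), of y "{u, w}"] that by auto
    ultimately show ?thesis using guardable_Un3[of E A "{u, w}" "{}" a B "{}" b C "{}" c] by simp
  qed
  then show ?thesis by (simp add: gtype_def)
qed

text \<open>The pair \<open>y\<close>, \<open>z\<close> consists of two corners of \<open>A\<close>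
  and meets \<open>B\<close> and \<open>C\<close>.\<close>

lemma gtype_100:
  assumes "gtype E A {v, y, z} 1 a" "gtype E B {x, v, z} 0 b" "gtype E C {x, y, v} 0 c"
  shows "gtype E ABC {x, y, z} 2 (a + b + c)"
proof -
  have "guardable E A {y, z} {} a" "guardable E B {y, z} {} b" "guardable E C {y, z} {} c"
    using gtype_1D[of E A _ a y z] gtype_0D[OF assms(2), of z] gtype_0D[OF assms(3), of y] assms(1) dist
    by auto
  then have "guardable E ABC {y, z} {} (a + b + c)"
    using guardable_Un3[of E A _ "{}" a B "{}" b C "{}" c] by simp
  then show ?thesis using dist unfolding gtype_def by auto
qed

text \<open>Covering \<open>v\<close> and \<open>z\<close> satisfies all parts. The apex is
  \<open>z\<close>: first the edge \<open>vz\<close> is used, and once \<open>z\<close> is covered,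
  the edge from \<open>v\<close> may end at any corner.\<close>

lemma gtype_110:
  assumes "gtype E A {v, y, z} 1 a" "gtype E B {x, v, z} 1 b" "gtype E C {x, y, v} 0 c"
  shows "gtype E ABC {x, y, z} 3 (a + b + c)"
proof -
  have *: "guardable E ABC N e (Suc (a + b + c))"
    if "e \<in> E" "v \<in> N \<union> e" "z \<in> N \<union> e" for N e
  proof (rule guardable_edge_Un3[OF that(1)])
    show "guardable E A (N \<union> e) {} a"
      by (rule gtype_1D[OF assms(1)[unfolded One_nat_def] _ _ _ that(2,3)]) (use dist in auto)
    show "guardable E B (N \<union> e) {} b"
      by (rule gtype_1D[OF assms(2)[unfolded One_nat_def] _ _ _ that(2,3)]) (use dist in auto)
    show "guardable E C (N \<union> e) {} c"
      by (rule gtype_0D[OF assms(3) _ that(2)]) simp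
  qed
  have "guardable E ABC {} {z} (Suc (a + b + c))"
    using *[OF spokes(3), of "{}"] by (auto intro: guardable_mono)
  moreover have "guardable E ABC {z} {u} (Suc (a + b + c))" if "u \<in> {x, y, z}" for u
    using *[OF edges, of v u "{z}"] that dist
    by (intro guardable_mono[of E ABC "{z}" "{v, u}" _ "{z}" "{u}"]) auto
  ultimately show ?thesis unfolding gtype_def by auto
qed

text \<open>Any two corners of \<open>A\<close> meet both \<open>B\<close> and \<open>C\<close>. One
  of the pair wanted by \<open>A\<close> becomes the apex, and the edge starts at the other
  one.\<close>

lemma gtype_200:
  assumes "gtype E A {v, y, z} 2 a" "gtype E B {x, v, z} 0 b" "gtype E C {x, y, v} 0 c"
  shows "gtype E ABC {x, y, z} 3 (a + b + c)"
proof -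
  obtain p q where pq: "p \<in> {v, y, z}" "q \<in> {v, y, z}" "p \<noteq> q" and "guardable E A {p, q} {} a"
    using assms(1) by (rule gtype_2E)
  note g = guardable_pair[OF this(4)]
  \<comment> \<open>The pair is ordered such that \<open>p\<close> is a corner of
    \<open>xyz\<close>, as the apex has to be.\<close>
  obtain p q where pq: "p \<in> {y, z}" "q \<in> {v, y, z}" "p \<noteq> q"
      and g: "\<And>N. p \<in> N \<Longrightarrow> q \<in> N \<Longrightarrow> guardable E A N {} a"
  proof (cases "p = v")
    case True
    then show ?thesis using pq g by (intro that[of q p]) simp_all
  next
    case False
    then show ?thesis using pq g by (intro that[of p q]) simp_all
  qed
  have pqB: "p \<in> {x, v, z} \<or> q \<in> {x, v, z}" and pqC: "p \<in> {x, y, v} \<or> q \<in> {x, y, v}"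
    using pq by auto
  have *: "guardable E ABC N {q, u} (Suc (a + b + c))"
    if p: "p \<in> N \<union> {q, u}" and u: "q \<noteq> u" "u \<in> {v, x, y, z}" for N u
  proof (rule guardable_edge_Un3)
    have q: "q \<in> N \<union> {q, u}" by simp
    show "{q, u} \<in> E" by (rule edges) (use u pq in auto)
    show "guardable E A (N \<union> {q, u}) {} a" by (rule g[OF p q])
    show "guardable E B (N \<union> {q, u}) {} b"
      using pqB gtype_0D[OF assms(2) _ p] gtype_0D[OF assms(2) _ q] by (elim disjE)
    show "guardable E C (N \<union> {q, u}) {} c"
      using pqC gtype_0D[OF assms(3) _ p] gtype_0D[OF assms(3) _ q] by (elim disjE)
  qed
  have "guardable E ABC {} {p} (Suc (a + b + c))"
    by (rule guardable_mono[OF *[of "{}" p]]) (use pq in auto)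
  moreover have "guardable E ABC {p} {u} (Suc (a + b + c))" if "u \<in> {x, y, z}" for u
  proof (cases "u = q")
    case True
    show ?thesis by (rule guardable_mono[OF *[of "{p}" p]]) (use pq True in auto)
  next
    case False
    show ?thesis by (rule guardable_mono[OF *[of "{p}" u]]) (use that False in auto)
  qed
  ultimately show ?thesis using pq(1) unfolding gtype_def by auto
qed

text \<open>From the given corner \<open>u\<close>, an edge from \<open>v\<close> to another corner
  \<open>w\<close> suffices: \<open>v\<close> lies in all parts, and each part also has
  \<open>u\<close> or \<open>w\<close>.\<close>

lemma gtype_111:
  assumes "gtype E A {v, y, z} 1 a" "gtype E B {x, v, z} 1 b" "gtype E C {x, y, v} 1 c"
  shows "gtype E ABC {x, y, z} 0 (a + b + c + 1)"
proof -
  have "guardable E ABC {u} {v, w} (Suc (a + b + c))" if "u \<in> {x, y, z}" "w \<in> {x, y, z}" "u \<noteq> w" for u w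
  proof (rule guardable_edge_Un3)
    show "{v, w} \<in> E" using edges that dist by auto
    show "guardable E A ({u} \<union> {v, w}) {} a"
      using gtype_1D[of E A _ a v y] gtype_1D[of E A _ a v z] assms(1) that dist by auto
    show "guardable E B ({u} \<union> {v, w}) {} b"
      using gtype_1D[of E B _ b v x] gtype_1D[of E B _ b v z] assms(2) that dist by auto
    show "guardable E C ({u} \<union> {v, w}) {} c"
      using gtype_1D[of E C _ c v x] gtype_1D[of E C _ c v y] assms(3) that dist by auto
  qed
  from this[of x y] this[of y x] this[of z x] show ?thesis
    using dist unfolding gtype_def by (auto intro: guardable_mono)
qed

text \<open>If \<open>y\<close> or \<open>z\<close> is given, the edge from \<open>v\<close> to the
  other one covers all of \<open>A\<close>, two corners of \<open>B\<close>, and \<open>v\<close> in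
  \<open>C\<close>. If \<open>x\<close> is given, the edge \<open>pq\<close> serves
  \<open>A\<close>, and \<open>v\<close> or \<open>z\<close> on it is the second corner for
  \<open>B\<close>.\<close>

lemma gtype_210:
  assumes "gtype E A {v, y, z} 2 a" "gtype E B {x, v, z} 1 b" "gtype E C {x, y, v} 0 c"
  shows "gtype E ABC {x, y, z} 0 (a + b + c + 1)"
proof -
  obtain p q where pq: "p \<in> {v, y, z}" "q \<in> {v, y, z}" "p \<noteq> q" and "guardable E A {p, q} {} a"
    using assms(1) by (rule gtype_2E)
  note g = guardable_pair[OF this(4)]
  have B: "guardable E B N {} b" if "s \<in> {x, v, z}" "t \<in> {x, v, z}" "s \<noteq> t" "s \<in> N" "t \<in> N" for N s t
    using gtype_1D[of E B _ b s t] assms(2) that by auto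
  have *: "guardable E ABC {u} {} (a + b + c + 1)"
    if "e \<in> E" "p \<in> insert u e" "q \<in> insert u e" "s \<in> {x, v, z}" "t \<in> {x, v, z}" "s \<noteq> t"
      "s \<in> insert u e" "t \<in> insert u e" "w \<in> {x, y, v}" "w \<in> insert u e" for u e s t w
  proof (rule guardable_mono)
    show "guardable E ABC {u} e (Suc (a + b + c))"
    proof (rule guardable_edge_Un3[OF that(1)])
      show "guardable E A ({u} \<union> e) {} a" by (rule g) (use that(2,3) in simp_all)
      show "guardable E B ({u} \<union> e) {} b" by (rule B[OF that(4-6)]) (use that(7,8) in simp_all)
      show "guardable E C ({u} \<union> e) {} c"
        by (rule gtype_0D[OF assms(3) that(9)]) (use that(10) in simp)
    qed
  qed simp_all
  have e: "{p, q} \<in> E" "{v, x} \<in> E" "{v, y} \<in> E" "{v, z} \<in> E" "{y, v} \<in> E" using edges pq dist by auto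
  have "guardable E ABC {x} {} (a + b + c + 1)"
  proof (cases "v \<in> {p, q}")
    case True
    then show ?thesis using *[OF e(1), of x x v x] dist by auto
  next
    case False
    then show ?thesis using *[OF e(1), of x x z x] pq dist by auto
  qed
  moreover have "guardable E ABC {y} {} (a + b + c + 1)"
    using *[OF e(2), of y x v x] *[OF e(4), of y v z v] pq dist by auto
  moreover have "guardable E ABC {z} {} (a + b + c + 1)"
    using *[OF e(3), of z v z v] pq dist by auto
  ultimately show ?thesis unfolding gtype_def by auto
qed

text \<open>The edge that \<open>A\<close> spends anyway must reach the part that misses the given
  corner. If \<open>y\<close> is given, this is \<open>B\<close>, and \<open>p\<close> is a corner
  of \<open>B\<close> unless \<open>p = y\<close>; but then \<open>v\<close> can be chosen. The
  corner \<open>z\<close> is similar, and \<open>x\<close> lies in both \<open>B\<close> and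
  \<open>C\<close>.\<close>

lemma gtype_300:
  assumes "gtype E A {v, y, z} 3 a" "gtype E B {x, v, z} 0 b" "gtype E C {x, y, v} 0 c"
  shows "gtype E ABC {x, y, z} 0 (a + b + c + 1)"
proof -
  obtain p where "apex E A {v, y, z} a p"
    using assms(1) by (rule gtype_3E)
  note p = apexD[OF this]
  have *: "guardable E ABC {u} {} (a + b + c + 1)"
    if "guardable E A {u} {w} (Suc a)" "s \<in> {x, v, z}" "s \<in> {u, w}" "t \<in> {x, y, v}" "t \<in> {u, w}" for u w s t
  proof (rule guardable_mono)
    show "guardable E ABC {u} ({w} \<union> {} \<union> {}) (Suc a + b + c)"
    proof (rule guardable_Un3[OF that(1)])
      show "guardable E B ({u} \<union> {w}) {} b"
        by (rule gtype_0D[OF assms(2) that(2)]) (use that(3) in auto)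
      show "guardable E C ({u} \<union> {w} \<union> {}) {} c"
        by (rule gtype_0D[OF assms(3) that(4)]) (use that(5) in auto)
    qed
  qed simp_all
  have "guardable E ABC {x} {} (a + b + c + 1)" by (rule *[of x p x x, OF p(2)]) simp_all
  moreover have "guardable E ABC {y} {} (a + b + c + 1)"
  proof (cases "p = y")
    case True
    show ?thesis by (rule *[of y v v v, OF p(3)]) (use True in simp_all)
  next
    case False
    show ?thesis by (rule *[of y p p y, OF p(2)]) (use False p(1) in auto)
  qed
  moreover have "guardable E ABC {z} {} (a + b + c + 1)"
  proof (cases "p = z")
    case True
    show ?thesis by (rule *[of z v v v, OF p(3)]) (use True in simp_all)
  next
    case False
    show ?thesis by (rule *[of z p z p, OF p(2)]) (use False p(1) in auto)
  qed
  ultimately show ?thesis unfolding gtype_def by auto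
qed

end

text \<open>Either \<open>p\<close> is covered already and the edge is free to cover
  \<open>c\<close>, or \<open>p\<close> is the third corner, and covering it leaves no corner
  uncovered.\<close>

lemma gtype_3_two:
  assumes "gtype E F K 3 j" "triangle_in E K" "a \<in> K" "b \<in> K" "a \<noteq> b" "a \<in> N" "b \<in> N" "c \<in> K"
  shows "guardable E F N {c} (Suc j)"
proof -
  obtain p where "apex E F K j p"
    using assms(1) by (rule gtype_3E)
  note p = apexD[OF this]
  show ?thesis
  proof (cases "p \<in> N")
    case True
    then show ?thesis using p(3) assms(8) by simp
  next
    case False
    then have "K = {a, b, p}"
      using triangle_inE[OF assms(2-5)] p(1) assms(6,7) by (metis insertE singletonD)
    then have "c \<in> N \<union> {p}" using assms(6-8) by auto
    then show ?thesis by (intro guardable_mono[OF p(2)]) auto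
  qed
qed

text \<open>Which pair is wanted is unknown, so the safe choice is to cover all corners.\<close>

lemma gtype_2_cover:
  assumes "gtype E F K 2 j" "K \<subseteq> N"
  shows "guardable E F N {} j"
  using assms(1) by (rule gtype_2E) (use assms(2) in \<open>auto intro: guardable_pair\<close>)

section \<open>Nodes whose child types add up to at least five\<close>

context wheel
begin

lemma gtype_1I:
  assumes "guardable E F {x, y} {} k" "guardable E F {x, z} {} k" "guardable E F {y, z} {} k"
  shows "gtype E F {x, y, z} 1 k"
  using assms unfolding gtype_def by (auto simp: insert_commute)

text \<open>Given two corners, the edge from \<open>v\<close> to the third completes the cover of
  all four vertices.\<close>

lemma gtype_222:
  assumes "gtype E A {v, y, z} 2 a" "gtype E B {x, v, z} 2 b" "gtype E C {x, y, v} 2 c"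
  shows "gtype E ABC {x, y, z} 1 (a + b + c + 1)"
proof -
  have "guardable E ABC N {} (a + b + c + 1)" if "{v, x, y, z} \<subseteq> N \<union> {v, w}" "{v, w} \<in> E" for N w
    by (rule guardable_mono[OF guardable_edge_Un3[OF that(2)
              gtype_2_cover[OF assms(1)] gtype_2_cover[OF assms(2)] gtype_2_cover[OF assms(3)]]])
       (use that in auto)
  from this[of _ x] this[of _ y] this[of _ z] show ?thesis
    using spokes by (intro gtype_1I) auto
qed

text \<open>Given \<open>y\<close> and \<open>z\<close>, the edge of \<open>A\<close> can be made to
  cover \<open>v\<close>. Given \<open>x\<close> and \<open>y\<close>, \<open>C\<close> is satisfied
  and \<open>B\<close> lacks one more corner: whichever of \<open>v\<close> and \<open>z\<close> is
  gained from \<open>A\<close> will do. The pair \<open>x\<close>, \<open>z\<close> is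
  symmetric.\<close>

lemma gtype_311:
  assumes A: "gtype E A {v, y, z} 3 a" and "gtype E B {x, v, z} 1 b" "gtype E C {x, y, v} 1 c"
  shows "gtype E ABC {x, y, z} 1 (a + b + c + 1)"
proof -
  obtain p where p': "apex E A {v, y, z} a p"
    using A by (rule gtype_3E)
  note B = gtype_1D[OF assms(2)[unfolded One_nat_def]] and C = gtype_1D[OF assms(3)[unfolded One_nat_def]]
  have *: "guardable E ABC N {} (a + b + c + 1)"
    if "guardable E A N {u} (Suc a)" "guardable E B (N \<union> {u}) {} b" "guardable E C (N \<union> {u}) {} c" for N u
    by (rule guardable_mono[OF guardable_Un3[of E A N "{u}" "Suc a" B "{}" b C "{}" c]])
       (use that in simp_all)
  show ?thesis
  proof (rule gtype_1I)
    have "guardable E A {y, z} {v} (Suc a)"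
      by (rule gtype_3_two[OF A triangles(1), of y z]) (use dist in auto)
    then show "guardable E ABC {y, z} {} (a + b + c + 1)"
      by (rule *; intro B[of v z] C[of v y]) (use dist in auto)
    have "guardable E A {x, y} {v} (Suc a) \<or> guardable E A {x, y} {z} (Suc a)"
      by (rule apex_gain[OF p']) (use dist in auto)
    then show "guardable E ABC {x, y} {} (a + b + c + 1)"
    proof
      assume "guardable E A {x, y} {v} (Suc a)"
      then show ?thesis by (rule *; intro B[of x v] C[of x y]) (use dist in auto)
    next
      assume "guardable E A {x, y} {z} (Suc a)"
      then show ?thesis by (rule *; intro B[of x z] C[of x y]) (use dist in auto)
    qed
    have "guardable E A {x, z} {v} (Suc a) \<or> guardable E A {x, z} {y} (Suc a)"
      by (rule apex_gain[OF p']) (use dist in auto)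
    then show "guardable E ABC {x, z} {} (a + b + c + 1)"
    proof
      assume "guardable E A {x, z} {v} (Suc a)"
      then show ?thesis by (rule *; intro B[of x z] C[of x v]) (use dist in auto)
    next
      assume "guardable E A {x, z} {y} (Suc a)"
      then show ?thesis by (rule *; intro B[of x z] C[of x y]) (use dist in auto)
    qed
  qed
qed

text \<open>The pair of corners required for \<open>i = 2\<close> may be selected after the pair
  \<open>s\<close>, \<open>t\<close> wanted by \<open>B\<close> and the apex \<open>p\<close> of
  \<open>A\<close> are known. If \<open>v\<close> is wanted, the selection ensures that
  \<open>A\<close> can cover it.\<close>

lemma gtype_320:
  assumes A: "gtype E A {v, y, z} 3 a" and "gtype E B {x, v, z} 2 b" "gtype E C {x, y, v} 0 c"
  shows "gtype E ABC {x, y, z} 2 (a + b + c + 1)"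
proof -
  obtain p where p': "apex E A {v, y, z} a p"
    using A by (rule gtype_3E)
  note p = apexD[OF p']
  obtain s t where st: "s \<in> {x, v, z}" "t \<in> {x, v, z}" "s \<noteq> t" and "guardable E B {s, t} {} b"
    using assms(2) by (rule gtype_2E)
  note B = guardable_pair[OF this(4)]
  have *: "guardable E ABC N {} (a + b + c + 1)"
    if "guardable E A N {u} (Suc a)" "{s, t} \<subseteq> N \<union> {u}" "w \<in> {x, y, v}" "w \<in> N \<union> {u}" for N u w
  proof (rule guardable_mono)
    show "guardable E ABC N ({u} \<union> {} \<union> {}) (Suc a + b + c)"
    proof (rule guardable_Un3[OF that(1)])
      show "guardable E B (N \<union> {u}) {} b" by (rule B) (use that(2) in simp_all)
      show "guardable E C (N \<union> {u} \<union> {}) {} c"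
        by (rule gtype_0D[OF assms(3) that(3)]) (use that(4) in simp)
    qed
  qed simp_all
  have I: "gtype E ABC {x, y, z} 2 (a + b + c + 1)"
    if "guardable E ABC {i, j} {} (a + b + c + 1)" "i \<in> {x, y, z}" "j \<in> {x, y, z}" "i \<noteq> j" for i j
    using that unfolding gtype_def by auto
  consider "{s, t} = {x, z}" | "{s, t} = {x, v}" | "{s, t} = {v, z}" using st dist by auto
  then show ?thesis
  proof cases
    case 1
    have "guardable E ABC {x, z} {} (a + b + c + 1)"
      by (rule *[OF p(2), of _ x]) (use 1 in auto)
    then show ?thesis by (rule I) (use dist in auto)
  next
    case 2
    show ?thesis
    proof (cases "p = z")
      case True
      then have "guardable E A {x, z} {v} (Suc a)" by (intro p(3)) auto
      then have "guardable E ABC {x, z} {} (a + b + c + 1)"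
        by (rule *[of _ _ x]) (use 2 in auto)
      then show ?thesis by (rule I) (use dist in auto)
    next
      case False
      have "guardable E A {x, y} {v} (Suc a)"
      proof (cases "p = v")
        case True
        then show ?thesis using p(2) by simp
      next
        case False
        with \<open>p \<noteq> z\<close> p(1) have "p = y" by simp
        then show ?thesis by (intro p(3)) auto
      qed
      then have "guardable E ABC {x, y} {} (a + b + c + 1)"
        by (rule *[of _ _ x]) (use 2 in auto)
      then show ?thesis by (rule I) (use dist in auto)
    qed
  next
    case 3
    have "guardable E A {y, z} {v} (Suc a)"
      by (rule gtype_3_two[OF A triangles(1), of y z]) (use dist in auto)
    then have "guardable E ABC {y, z} {} (a + b + c + 1)"
      by (rule *[of _ _ v]) (use 3 in auto)
    then show ?thesis by (rule I) (use dist in auto)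
  qed
qed

text \<open>The given corner, one corner gained from \<open>A\<close> and the two ends of an extra
  edge are all four vertices, as any two of these are adjacent.\<close>

lemma gtype_322:
  assumes A: "gtype E A {v, y, z} 3 a" and "gtype E B {x, v, z} 2 b" "gtype E C {x, y, v} 2 c"
  shows "gtype E ABC {x, y, z} 0 (a + b + c + 2)"
proof -
  obtain p where p': "apex E A {v, y, z} a p"
    using A by (rule gtype_3E)
  note p = apexD[OF p']
  have *: "guardable E ABC N {} (a + b + c + 2)"
    if "guardable E A N {u} (Suc a)" "{s, t} \<in> E" "{v, x, y, z} \<subseteq> N \<union> {u} \<union> {s, t}" for N u s t
  proof -
    have "guardable E B (N \<union> {u} \<union> {s, t}) {} b"
      by (rule gtype_2_cover[OF assms(2)]) (use that(3) in blast)
    moreover have "guardable E C (N \<union> {u} \<union> {s, t}) {} c"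
      by (rule gtype_2_cover[OF assms(3)]) (use that(3) in blast)
    ultimately show ?thesis
      by (rule guardable_mono[OF guardable_Un_edge_Un[OF that(1,2)]]) simp_all
  qed
  have "guardable E ABC {x} {} (a + b + c + 2)"
  proof -
    consider "p = v" | "p = y" | "p = z" using p(1) by blast
    then show ?thesis
    proof cases
      case 1
      show ?thesis by (rule *[OF p(2) rim(2)]) (use 1 in blast)
    next
      case 2
      show ?thesis by (rule *[OF p(2) spokes(3)]) (use 2 in blast)
    next
      case 3
      show ?thesis by (rule *[OF p(2) spokes(2)]) (use 3 in blast)
    qed
  qed
  moreover have "guardable E ABC {y} {} (a + b + c + 2)"
  proof -
    have "guardable E A {y} {v} (Suc a) \<or> guardable E A {y} {z} (Suc a)"
      by (rule apex_gain[OF p']) auto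
    then show ?thesis
    proof
      assume "guardable E A {y} {v} (Suc a)"
      then show ?thesis by (rule *[OF _ rim(3)]) blast
    next
      assume "guardable E A {y} {z} (Suc a)"
      then show ?thesis by (rule *[OF _ spokes(1)]) blast
    qed
  qed
  moreover have "guardable E ABC {z} {} (a + b + c + 2)"
  proof -
    have "guardable E A {z} {v} (Suc a) \<or> guardable E A {z} {y} (Suc a)"
      by (rule apex_gain[OF p']) auto
    then show ?thesis
    proof
      assume "guardable E A {z} {v} (Suc a)"
      then show ?thesis by (rule *[OF _ rim(1)]) blast
    next
      assume "guardable E A {z} {y} (Suc a)"
      then show ?thesis by (rule *[OF _ spokes(1)]) blast
    qed
  qed
  ultimately show ?thesis unfolding gtype_def by simp
qed

text \<open>The edges that \<open>A\<close> and \<open>B\<close> spend anyway must provide two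
  covered corners of \<open>C\<close>, where the part treated second profits from the first. Given
  \<open>x\<close>, for example, either \<open>p\<close> is another corner of \<open>C\<close>, or
  \<open>p = z\<close>; then \<open>B\<close> has \<open>x\<close> and \<open>z\<close> covered and
  can cover \<open>v\<close>.\<close>

lemma gtype_331:
  assumes A: "gtype E A {v, y, z} 3 a" and B: "gtype E B {x, v, z} 3 b" and "gtype E C {x, y, v} 1 c"
  shows "gtype E ABC {x, y, z} 0 (a + b + c + 2)"
proof -
  obtain p where "apex E A {v, y, z} a p"
    using A by (rule gtype_3E)
  note p = apexD[OF this]
  obtain q where "apex E B {x, v, z} b q"
    using B by (rule gtype_3E)
  note q = apexD[OF this]
  have C: "guardable E C N {} c" if "s \<in> {x, y, v}" "t \<in> {x, y, v}" "s \<noteq> t" "s \<in> N" "t \<in> N" for N s t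
    using gtype_1D[of E C _ c s t] assms(3) that by auto
  have AB: "guardable E ABC N {} (a + b + c + 2)"
    if "guardable E A N {u} (Suc a)" "guardable E B (insert u N) {w} (Suc b)"
      "s \<in> {x, y, v}" "t \<in> {x, y, v}" "s \<noteq> t" "s \<in> {u, w} \<union> N" "t \<in> {u, w} \<union> N" for N u w s t
    using guardable_Un3[of E A N "{u}" "Suc a" B "{w}" "Suc b" C "{}" c] that C[of s t "insert w (insert u N)"]
    by (auto intro: guardable_mono)
  have BA: "guardable E ABC N {} (a + b + c + 2)"
    if "guardable E B N {u} (Suc b)" "guardable E A (insert u N) {w} (Suc a)"
      "s \<in> {x, y, v}" "t \<in> {x, y, v}" "s \<noteq> t" "s \<in> {u, w} \<union> N" "t \<in> {u, w} \<union> N" for N u w s t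
    using guardable_Un3[of E B N "{u}" "Suc b" A "{w}" "Suc a" C "{}" c] that C[of s t "insert w (insert u N)"]
    by (auto intro: guardable_mono simp: Un_ac add_ac)
  have Az: "guardable E A N {u} (Suc a)" if "w \<in> {v, y, z}" "t \<in> {v, y, z}" "w \<noteq> t" "w \<in> N" "t \<in> N" "u \<in> {v, y, z}" for N u w t
    using gtype_3_two[OF A triangles(1)] that by blast
  have Bz: "guardable E B N {u} (Suc b)" if "w \<in> {x, v, z}" "t \<in> {x, v, z}" "w \<noteq> t" "w \<in> N" "t \<in> N" "u \<in> {x, v, z}" for N u w t
    using gtype_3_two[OF B triangles(2)] that by blast
  have "guardable E ABC {x} {} (a + b + c + 2)"
  proof (cases "p = z")
    case True
    show ?thesis by (rule AB[of "{x}" p v x v]; (rule p(2) Bz[of x z])?; use True dist in auto)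
  next
    case False
    show ?thesis by (rule AB[of "{x}" p q x p]; (rule p(2) q(2))?; use False p(1) dist in auto)
  qed
  moreover have "guardable E ABC {y} {} (a + b + c + 2)"
  proof (cases "q = z")
    case True
    show ?thesis by (rule BA[of "{y}" q v y v]; (rule q(2) Az[of y z])?; use True dist in auto)
  next
    case False
    show ?thesis by (rule BA[of "{y}" q p y q]; (rule q(2) p(2))?; use False q(1) dist in auto)
  qed
  moreover have "guardable E ABC {z} {} (a + b + c + 2)"
  proof (cases "p = y")
    case True
    show ?thesis
    proof (cases "q = z")
      case True
      show ?thesis by (rule AB[of "{z}" p x y x]; (rule p(2) q(3))?; use True \<open>p = y\<close> dist in auto)
    next
      case False
      show ?thesis by (rule AB[of "{z}" p q y q]; (rule p(2) q(2))?; use False q(1) \<open>p = y\<close> dist in auto)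
    qed
  next
    case False
    then have "guardable E A {z} {v} (Suc a)" using p by auto
    then show ?thesis by (rule AB[of "{z}" v x v x, OF _ Bz[of v z]]) (use dist in auto)
  qed
  ultimately show ?thesis unfolding gtype_def by auto
qed

text \<open>As the pair wanted by \<open>C\<close> is unknown, the edges of \<open>A\<close> and
  \<open>B\<close> have to complete the cover of \<open>x\<close>, \<open>y\<close> and
  \<open>v\<close>.\<close>

lemma gtype_332:
  assumes A: "gtype E A {v, y, z} 3 a" and B: "gtype E B {x, v, z} 3 b" and C: "gtype E C {x, y, v} 2 c"
  shows "gtype E ABC {x, y, z} 1 (a + b + c + 2)"
proof -
  obtain p where "apex E A {v, y, z} a p"
    using A by (rule gtype_3E)
  note p = apexD[OF this]
  obtain q where "apex E B {x, v, z} b q"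
    using B by (rule gtype_3E)
  note q = apexD[OF this]
  have AB: "guardable E ABC N {} (a + b + c + 2)"
    if "guardable E A N {u} (Suc a)" "guardable E B (insert u N) {w} (Suc b)"
      "{x, y, v} \<subseteq> {u, w} \<union> N" for N u w
    using guardable_Un3[of E A N "{u}" "Suc a" B "{w}" "Suc b" C "{}" c] that
      gtype_2_cover[OF C, of "insert w (insert u N)"]
    by (auto intro: guardable_mono)
  have BA: "guardable E ABC N {} (a + b + c + 2)"
    if "guardable E B N {u} (Suc b)" "guardable E A (insert u N) {w} (Suc a)"
      "{x, y, v} \<subseteq> {u, w} \<union> N" for N u w
    using guardable_Un3[of E B N "{u}" "Suc b" A "{w}" "Suc a" C "{}" c] that
      gtype_2_cover[OF C, of "insert w (insert u N)"]
    by (auto intro: guardable_mono simp: Un_ac add_ac)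
  have Az: "guardable E A N {u} (Suc a)" if "w \<in> {v, y, z}" "t \<in> {v, y, z}" "w \<noteq> t" "w \<in> N" "t \<in> N" "u \<in> {v, y, z}" for N u w t
    using gtype_3_two[OF A triangles(1)] that by blast
  have Bz: "guardable E B N {u} (Suc b)" if "w \<in> {x, v, z}" "t \<in> {x, v, z}" "w \<noteq> t" "w \<in> N" "t \<in> N" "u \<in> {x, v, z}" for N u w t
    using gtype_3_two[OF B triangles(2)] that by blast
  show ?thesis
  proof (rule gtype_1I)
    show "guardable E ABC {x, y} {} (a + b + c + 2)"
    proof (cases "p = z")
      case True
      show ?thesis by (rule AB[of "{x, y}" p v]; (rule p(2) Bz[of x z])?; use True dist in auto)
    next
      case False
      then have "guardable E A {x, y} {v} (Suc a)" using p by auto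
      then show ?thesis by (rule AB[of "{x, y}" v q, OF _ q(2)]) auto
    qed
    show "guardable E ABC {x, z} {} (a + b + c + 2)"
      by (rule BA[of "{x, z}" v y]; (rule Bz[of x z] Az[of v z])?; use dist in auto)
    show "guardable E ABC {y, z} {} (a + b + c + 2)"
      by (rule AB[of "{y, z}" v x]; (rule Az[of y z] Bz[of v z])?; use dist in auto)
  qed
qed

text \<open>Each part spends one edge; one of these three is the edge that the new type spends
  anyway, hence \<open>+ 2\<close>. The apex is \<open>p\<close> or \<open>q\<close> if one of them
  is a corner of \<open>xyz\<close>. If both are \<open>v\<close>, it is \<open>z\<close>:
  \<open>A\<close> covers \<open>v\<close>, and this lets \<open>B\<close> cover
  \<open>z\<close>.\<close>

lemma gtype_333:
  assumes A: "gtype E A {v, y, z} 3 a" and B: "gtype E B {x, v, z} 3 b" and C: "gtype E C {x, y, v} 3 c"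
  shows "gtype E ABC {x, y, z} 3 (a + b + c + 2)"
proof -
  obtain p where "apex E A {v, y, z} a p"
    using A by (rule gtype_3E)
  note p = apexD[OF this]
  obtain q where "apex E B {x, v, z} b q"
    using B by (rule gtype_3E)
  note q = apexD[OF this]
  obtain r where "apex E C {x, y, v} c r"
    using C by (rule gtype_3E)
  note r = apexD(2)[OF this]
  have ABC: "guardable E ABC N P (Suc (a + b + c + 2))"
    if "guardable E A N {u} (Suc a)" "guardable E B (insert u N) {w} (Suc b)"
      "guardable E C (insert w (insert u N)) {t} (Suc c)" "P \<subseteq> {u, w, t} \<union> N" for N u w t P
    by (rule guardable_mono[OF guardable_Un3[of E A N "{u}" "Suc a" B "{w}" "Suc b" C "{t}" "Suc c"]])
       (use that in auto)
  have BAC: "guardable E ABC N P (Suc (a + b + c + 2))"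
    if "guardable E B N {u} (Suc b)" "guardable E A (insert u N) {w} (Suc a)"
      "guardable E C (insert w (insert u N)) {t} (Suc c)" "P \<subseteq> {u, w, t} \<union> N" for N u w t P
  proof -
    have "guardable E (B \<union> A \<union> C) N ({u} \<union> {w} \<union> {t}) (Suc b + Suc a + Suc c)"
      by (rule guardable_Un3) (use that in auto)
    then have "guardable E ABC N ({u} \<union> {w} \<union> {t}) (Suc b + Suc a + Suc c)"
      by (simp add: Un_ac)
    then show ?thesis by (rule guardable_mono) (use that in auto)
  qed
  have Az: "guardable E A N {u} (Suc a)" if "w \<in> {v, y, z}" "t \<in> {v, y, z}" "w \<noteq> t" "w \<in> N" "t \<in> N" "u \<in> {v, y, z}" for N u w t
    using gtype_3_two[OF A triangles(1)] that by blast
  have Bz: "guardable E B N {u} (Suc b)" if "w \<in> {x, v, z}" "t \<in> {x, v, z}" "w \<noteq> t" "w \<in> N" "t \<in> N" "u \<in> {x, v, z}" for N u w t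
    using gtype_3_two[OF B triangles(2)] that by blast
  have Cz: "guardable E C N {u} (Suc c)" if "w \<in> {x, y, v}" "t \<in> {x, y, v}" "w \<noteq> t" "w \<in> N" "t \<in> N" "u \<in> {x, y, v}" for N u w t
    using gtype_3_two[OF C triangles(3)] that by blast
  have "\<exists>s\<in>{x, y, z}. guardable E ABC {} {s} (Suc (a + b + c + 2)) \<and>
      (\<forall>u\<in>{x, y, z}. guardable E ABC {s} {u} (Suc (a + b + c + 2)))"
  proof -
    consider "p \<in> {y, z}" | "p = v" "q \<in> {x, z}" | "p = v" "q = v" using p(1) q(1) by auto
    then show ?thesis
    proof cases
      case 1
      have "guardable E ABC {} {p} (Suc (a + b + c + 2))"
        by (rule ABC[OF p(2) q(2) r]) simp
      moreover have "guardable E ABC {p} {u} (Suc (a + b + c + 2))" if "u \<in> {y, z}" for u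
        by (rule ABC[of "{p}" u q r "{u}"]; (rule p(3) q(2) r)?; use that dist in auto)
      moreover have "guardable E ABC {p} {x} (Suc (a + b + c + 2))"
      proof (cases "p = z")
        case True
        show ?thesis by (rule ABC[of "{p}" v x r "{x}"]; (rule p(3) Bz[of v z] r)?; use True dist in auto)
      next
        case False
        show ?thesis by (rule ABC[of "{p}" v q x "{x}"]; (rule p(3) q(2) Cz[of v y])?; use False 1 dist in auto)
      qed
      ultimately show ?thesis using 1 by auto
    next
      case 2
      have "guardable E ABC {} {q} (Suc (a + b + c + 2))"
        by (rule ABC[OF p(2) q(2) r]) simp
      moreover have "guardable E ABC {q} {u} (Suc (a + b + c + 2))" if "u \<in> {x, z}" for u
        by (rule BAC[of "{q}" u p r "{u}"]; (rule q(3) p(2) r)?; use that dist in auto)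
      moreover have "guardable E ABC {q} {y} (Suc (a + b + c + 2))"
      proof (cases "q = z")
        case True
        show ?thesis by (rule BAC[of "{q}" v y r "{y}"]; (rule q(3) Az[of v z] r)?; use True dist in auto)
      next
        case False
        show ?thesis by (rule BAC[of "{q}" v p y "{y}"]; (rule q(3) p(2) Cz[of v x])?; use False 2 dist in auto)
      qed
      ultimately show ?thesis using 2 by auto
    next
      case 3
      have "guardable E ABC {} {z} (Suc (a + b + c + 2))"
        by (rule ABC[of "{}" p z r "{z}"]; (rule p(2) q(3) r)?; use 3 dist in auto)
      moreover have "guardable E ABC {z} {x, y, z} (Suc (a + b + c + 2))"
        by (rule ABC[of "{z}" p x y "{x, y, z}"]; (rule p(2) q(3) Cz[of x v])?; use 3 dist in auto)
      then have "guardable E ABC {z} {u} (Suc (a + b + c + 2))" if "u \<in> {x, y, z}" for u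
        by (rule guardable_mono) (use that in auto)
      ultimately show ?thesis by auto
    qed
  qed
  then show ?thesis unfolding gtype_def by simp
qed

section \<open>Guarding the outer triangle as well\<close>

lemma guardable_outer:
  assumes "guardable E F {} {u} k" "u \<in> K"
  shows "guardable E (insert K F) {} {} k"
proof -
  have "guardable E {K} {u} {} 0"
    by (rule guardableI[of "{}"]) (use assms(2) in auto)
  then have "guardable E (F \<union> {K}) {} {u} k"
    using guardable_Un[OF assms(1), of "{K}" "{}" 0] by simp
  then show ?thesis by (auto intro: guardable_mono)
qed

text \<open>\<open>C\<close> fails to contain only \<open>z\<close>, and the outer triangle only
  \<open>v\<close>, so two different apexes serve both. If the apexes coincide, \<open>B\<close>
  finds its own covered by \<open>A\<close> and can cover the other one of \<open>v\<close> and
  \<open>z\<close>.\<close>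

lemma outer_330:
  assumes A: "gtype E A {v, y, z} 3 a" and B: "gtype E B {x, v, z} 3 b" and C: "gtype E C {x, y, v} 0 c"
  shows "guardable E (insert {x, y, z} ABC) {} {} (a + b + c + 2)"
proof -
  obtain p where "apex E A {v, y, z} a p"
    using A by (rule gtype_3E)
  note p = apexD[OF this]
  obtain q where "apex E B {x, v, z} b q"
    using B by (rule gtype_3E)
  note q = apexD[OF this]
  have *: "guardable E (insert {x, y, z} ABC) {} {} (a + b + c + 2)"
    if "guardable E B {p} {w} (Suc b)" "s \<in> {x, y, v}" "s \<in> {p, w}" "t \<in> {x, y, z}" "t \<in> {p, w}" for w s t
  proof (rule guardable_outer[OF _ that(4)])
    show "guardable E ABC {} {t} (a + b + c + 2)"
      using guardable_Un3[of E A "{}" "{p}" "Suc a" B "{w}" "Suc b" C "{}" c] p(2) that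
        gtype_0D[OF C, of s "{w, p}"]
      by (auto intro: guardable_mono)
  qed
  show ?thesis
  proof (cases "q = p")
    case True
    then have "p \<in> {v, z}" using p(1) q(1) dist by auto
    then show ?thesis using *[of v v z] *[of z v z] q(3) True by auto
  next
    case False
    then show ?thesis using *[of q p q] *[of q p p] *[of q q p] q(2) p(1) q(1) dist by auto
  qed
qed

text \<open>The edge of \<open>A\<close> covers \<open>p\<close>. The one extra edge is chosen by
  \<open>p\<close> and the pair wanted by \<open>B\<close> such that two corners of \<open>C\<close>
  and an outer corner are covered too.\<close>

lemma outer_321:
  assumes A: "gtype E A {v, y, z} 3 a" and "gtype E B {x, v, z} 2 b" and C: "gtype E C {x, y, v} 1 c"
  shows "guardable E (insert {x, y, z} ABC) {} {} (a + b + c + 2)"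
proof -
  obtain p where "apex E A {v, y, z} a p"
    using A by (rule gtype_3E)
  note p = apexD[OF this]
  obtain s t where st: "s \<in> {x, v, z}" "t \<in> {x, v, z}" "s \<noteq> t" and "guardable E B {s, t} {} b"
    using assms(2) by (rule gtype_2E)
  note B = guardable_pair[OF this(4)]
  have *: "guardable E (insert {x, y, z} ABC) {} {} (a + b + c + 2)"
    if "e \<in> E" "s \<in> insert p e" "t \<in> insert p e" "i \<in> {x, y, v}" "j \<in> {x, y, v}" "i \<noteq> j"
      "i \<in> insert p e" "j \<in> insert p e" "u \<in> {x, y, z}" "u \<in> insert p e" for e i j u
  proof (rule guardable_outer[OF _ that(9)])
    have "guardable E C (insert p e) {} c" using gtype_1D[of E C _ c i j] C that by auto
    then show "guardable E ABC {} {u} (a + b + c + 2)"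
      using guardable_Un_edge_Un[of E A "{}" "{p}" "Suc a" e B b C c] p(2) that(1) B[of "insert p e"] that
      by (auto intro: guardable_mono)
  qed
  consider "{s, t} = {x, z}" | "{s, t} = {x, v}" | "{s, t} = {v, z}" using st dist by auto
  then show ?thesis
  proof cases
    case 1
    then show ?thesis
      using *[of "{x, z}" x p x] *[of "{v, x}" x v x] rim spokes p(1) dist by (auto simp: doubleton_eq_iff)
  next
    case 2
    then show ?thesis
      using *[of "{v, x}" x v x] spokes dist by (auto simp: doubleton_eq_iff)
  next
    case 3
    then show ?thesis
      using *[of "{v, z}" y v y] *[of "{x, z}" x v x] *[of "{v, x}" x v x] rim spokes p(1) dist
      by (auto simp: doubleton_eq_iff)
  qed
qed

text \<open>Every type can be weakened to 3, and then the additional edge covers the apex, which is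
  an outer corner.\<close>

lemma outer_gtype:
  assumes "gtype E F {x, y, z} i j" "i \<le> 3"
  shows "guardable E (insert {x, y, z} F) {} {} (Suc j)"
proof -
  have "gtype E F {x, y, z} 3 j" using gtype_mono[OF triangles(4) assms(1) assms(2)] by simp
  then obtain p where "apex E F {x, y, z} j p" by (rule gtype_3E)
  from guardable_outer[OF apexD(2)[OF this] apexD(1)[OF this]] show ?thesis .
qed

end

section \<open>The induction step for arbitrary child types\<close>

text \<open>Here \<open>s\<close> and \<open>t\<close> are the sums of the values \<open>i\<close> and \<open>j\<close> of the children; the second part is the
  bound for a root, whose outer triangle has to be guarded as well.\<close>

definition node_ok :: "'v set set \<Rightarrow> 'v set set \<Rightarrow> 'v set \<Rightarrow> nat \<Rightarrow> nat \<Rightarrow> bool" where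
  "node_ok E F K s t \<longleftrightarrow>
     (\<exists>i j. i \<le> 3 \<and> gtype E F K i (t + j) \<and> 2 * i + 7 * j \<le> 2 * s + 2) \<and>
     (\<exists>k. guardable E (insert K F) {} {} (t + k) \<and> 7 * k \<le> 2 * s + 8)"

context wheel
begin

text \<open>The condition \<open>7 * j < 2 * s + 2\<close> is the slack that pays for one more edge:
  it amounts to \<open>7 * Suc j \<le> 2 * s + 8\<close>.\<close>

lemma node_okI:
  assumes "gtype E F {x, y, z} i (t + j)" "i \<le> 3" "2 * i + 7 * j \<le> 2 * s + 2" "7 * j < 2 * s + 2"
  shows "node_ok E F {x, y, z} s t"
  unfolding node_ok_def
proof (intro conjI exI)
  show "guardable E (insert {x, y, z} F) {} {} (t + Suc j)"
    using outer_gtype[OF assms(1,2)] by simp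
qed (use assms in auto)

lemma node_ok_sorted:
  assumes A: "gtype E A {v, y, z} i a" and B: "gtype E B {x, v, z} j b" and C: "gtype E C {x, y, v} k c"
    and le: "k \<le> j" "j \<le> i" "i \<le> 3"
  shows "node_ok E ABC {x, y, z} (i + j + k) (a + b + c)"
proof -
  note mA = gtype_mono[OF triangles(1) A] and mB = gtype_mono[OF triangles(2) B]
    and mC = gtype_mono[OF triangles(3) C]
  \<comment> \<open>Of the twenty sorted triples, four are weakened to 2, 2, 2 and two to 3, 1,
    1.\<close>
  consider "i = 0" "j = 0" "k = 0" | "i = 1" "j = 0" "k = 0" | "i = 1" "j = 1" "k = 0"
    | "i = 2" "j = 0" "k = 0" | "i = 1" "j = 1" "k = 1" | "i = 2" "j = 1" "k = 0"
    | "i = 3" "j = 0" "k = 0" | "i = 2" "j \<le> 2" "k \<le> 2" "j + k \<ge> 2"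
    | "i = 3" "j = 1" "k \<le> 1" | "i = 3" "j = 2" "k = 0" | "i = 3" "j = 2" "k = 1" | "i = 3" "j = 2" "k = 2"
    | "i = 3" "j = 3" "k = 0" | "i = 3" "j = 3" "k = 1" | "i = 3" "j = 3" "k = 2" | "i = 3" "j = 3" "k = 3"
  proof -
    have "i = 0 \<or> i = 1 \<or> i = 2 \<or> i = 3" "j = 0 \<or> j = 1 \<or> j = 2 \<or> j = 3"
      "k = 0 \<or> k = 1 \<or> k = 2 \<or> k = 3"
      using le by linarith+
    with le that show ?thesis by (elim disjE) simp_all
  qed
  then show ?thesis
  proof cases
    case 1
    show ?thesis by (rule node_okI[of _ 1 _ 0]) (use 1 A B C gtype_000 in auto)
  next
    case 2
    show ?thesis by (rule node_okI[of _ 2 _ 0]) (use 2 A B C gtype_100 in auto)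
  next
    case 3
    show ?thesis by (rule node_okI[of _ 3 _ 0]) (use 3 A B C gtype_110 in auto)
  next
    case 4
    show ?thesis by (rule node_okI[of _ 3 _ 0]) (use 4 A B C gtype_200 in auto)
  next
    case 5
    show ?thesis by (rule node_okI[of _ 0 _ 1]) (use 5 A B C gtype_111 in auto)
  next
    case 6
    show ?thesis by (rule node_okI[of _ 0 _ 1]) (use 6 A B C gtype_210 in auto)
  next
    case 7
    show ?thesis by (rule node_okI[of _ 0 _ 1]) (use 7 A B C gtype_300 in auto)
  next
    case 8
    show ?thesis by (rule node_okI[of _ 1 _ 1]) (use 8 mA[of 2] mB[of 2] mC[of 2] gtype_222 in auto)
  next
    case 9
    show ?thesis by (rule node_okI[of _ 1 _ 1]) (use 9 mA[of 3] mB[of 1] mC[of 1] gtype_311 in auto)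
  next
    case 10
    show ?thesis by (rule node_okI[of _ 2 _ 1]) (use 10 A B C gtype_320 in auto)
  next
    \<comment> \<open>Here 7 * 2 = 2 * 6 + 2, so \<open>node_okI\<close> does not apply and the
      outer triangle must come for free. The same happens for 3, 3, 0.\<close>
    case 11
    then have "gtype E ABC {x, y, z} 0 (a + b + c + 2)"
      "guardable E (insert {x, y, z} ABC) {} {} (a + b + c + 2)"
      using A B C gtype_322 outer_321 mC[of 2] by auto
    then show ?thesis unfolding node_ok_def using 11 by (intro conjI exI[of _ 0] exI[of _ 2]) auto
  next
    case 12
    show ?thesis by (rule node_okI[of _ 0 _ 2]) (use 12 A B C gtype_322 in auto)
  next
    case 13
    then have "gtype E ABC {x, y, z} 0 (a + b + c + 2)"
      "guardable E (insert {x, y, z} ABC) {} {} (a + b + c + 2)"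
      using A B C gtype_331 outer_330 mC[of 1] by auto
    then show ?thesis unfolding node_ok_def using 13 by (intro conjI exI[of _ 0] exI[of _ 2]) auto
  next
    case 14
    show ?thesis by (rule node_okI[of _ 0 _ 2]) (use 14 A B C gtype_331 in auto)
  next
    case 15
    show ?thesis by (rule node_okI[of _ 1 _ 2]) (use 15 A B C gtype_332 in auto)
  next
    case 16
    show ?thesis by (rule node_okI[of _ 3 _ 2]) (use 16 A B C gtype_333 in auto)
  qed
qed

end

text \<open>Permuting \<open>x\<close>, \<open>y\<close>, \<open>z\<close> permutes the parts, so
  they may be assumed sorted.\<close>

lemma node_ok_gtype:
  assumes W: "distinct [v, x, y, z]" "{v, x} \<in> E" "{v, y} \<in> E" "{v, z} \<in> E"
      "{x, y} \<in> E" "{y, z} \<in> E" "{x, z} \<in> E"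
    and A: "gtype E A {v, y, z} i a" and B: "gtype E B {x, v, z} j b" and C: "gtype E C {x, y, v} k c"
    and le: "i \<le> 3" "j \<le> 3" "k \<le> 3"
  shows "node_ok E (A \<union> B \<union> C) {x, y, z} (i + j + k) (a + b + c)"
proof -
  have ABC: "gtype E A {v, y, z} i a" "gtype E A {v, z, y} i a" "gtype E A {y, v, z} i a"
    "gtype E A {y, z, v} i a" "gtype E A {z, v, y} i a" "gtype E A {z, y, v} i a"
    "gtype E B {v, x, z} j b" "gtype E B {v, z, x} j b" "gtype E B {x, v, z} j b"
    "gtype E B {x, z, v} j b" "gtype E B {z, v, x} j b" "gtype E B {z, x, v} j b"
    "gtype E C {v, x, y} k c" "gtype E C {v, y, x} k c" "gtype E C {x, v, y} k c"
    "gtype E C {x, y, v} k c" "gtype E C {y, v, x} k c" "gtype E C {y, x, v} k c"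
    using A B C by (simp_all add: insert_commute)
  have comm: "{x, z, y} = {x, y, z}" "{y, x, z} = {x, y, z}" "{y, z, x} = {x, y, z}"
    "{z, x, y} = {x, y, z}" "{z, y, x} = {x, y, z}" by auto
  have wheels: "wheel E v x y z" "wheel E v x z y" "wheel E v y x z" "wheel E v y z x"
    "wheel E v z x y" "wheel E v z y x"
    using W by (unfold_locales; auto simp: insert_commute)+
  consider "k \<le> j" "j \<le> i" | "j \<le> k" "k \<le> i" | "k \<le> i" "i \<le> j" | "i \<le> k" "k \<le> j"
    | "i \<le> j" "j \<le> k" | "j \<le> i" "i \<le> k" by linarith
  then show ?thesis
  proof cases
    case 1
    show ?thesis using wheel.node_ok_sorted[OF wheels(1), of A i a B j b C k c] ABC 1 le by simp
  next
    case 2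
    show ?thesis using wheel.node_ok_sorted[OF wheels(2), of A i a C k c B j b] ABC 2 le
      by (simp add: comm Un_ac add_ac)
  next
    case 3
    show ?thesis using wheel.node_ok_sorted[OF wheels(3), of B j b A i a C k c] ABC 3 le
      by (simp add: comm Un_ac add_ac)
  next
    case 4
    show ?thesis using wheel.node_ok_sorted[OF wheels(4), of B j b C k c A i a] ABC 4 le
      by (simp add: comm Un_ac add_ac)
  next
    case 5
    show ?thesis using wheel.node_ok_sorted[OF wheels(6), of C k c B j b A i a] ABC 5 le
      by (simp add: comm Un_ac add_ac)
  next
    case 6
    show ?thesis using wheel.node_ok_sorted[OF wheels(5), of C k c A i a B j b] ABC 6 le
      by (simp add: comm Un_ac add_ac)
  qed
qed

section \<open>Stackings\<close>

text \<open>The tree without its drawing: \<open>F\<close> holds the leaves, and the number counts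
  the inner nodes. The edges are those of the whole graph, which simplifies refining the tree:
  adding edges is harmless.\<close>

inductive stacking :: "'v set set \<Rightarrow> 'v set set \<Rightarrow> 'v set \<Rightarrow> nat \<Rightarrow> bool" for E where
  face: "stacking E {K} K 0"
| insert: "stacking E (A \<union> B \<union> C) {x, y, z} (Suc (a + b + c))"
    if "distinct [v, x, y, z]" "{v, x} \<in> E" "{v, y} \<in> E" "{v, z} \<in> E"
      "{x, y} \<in> E" "{y, z} \<in> E" "{x, z} \<in> E"
      "stacking E A {v, y, z} a" "stacking E B {x, v, z} b" "stacking E C {x, y, v} c"

lemma stacking_mono:
  assumes "stacking E F K n" "E \<subseteq> E'"
  shows "stacking E' F K n"
  using assms(1)
proof induction
  case (face K)
  show ?case by (rule stacking.face)
next
  case (insert v x y z A a B b C c)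
  show ?case by (rule stacking.insert[of v]) (use insert assms(2) in auto)
qed

text \<open>With three outer vertices added, \<open>2 * n + 6\<close> is twice the number of all
  vertices. A node contributes 2 to the first bound, for its new vertex.\<close>

lemma stacking_gtype:
  assumes "stacking E F K n"
  shows "(\<exists>i j. i \<le> 3 \<and> gtype E F K i j \<and> 2 * i + 7 * j \<le> 2 * n) \<and>
    (n > 0 \<longrightarrow> (\<exists>k. guardable E (insert K F) {} {} k \<and> 7 * k \<le> 2 * n + 6))"
  using assms
proof induction
  case (face K)
  have "gtype E {K} K 0 0"
    unfolding gtype_def by (auto intro!: guardableI[of "{}"])
  then show ?case by auto
next
  case (insert v x y z A a B b C c)
  from insert.IH obtain i1 j1 i2 j2 i3 j3 where
    1: "i1 \<le> 3" "gtype E A {v, y, z} i1 j1" "2 * i1 + 7 * j1 \<le> 2 * a" and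
    2: "i2 \<le> 3" "gtype E B {x, v, z} i2 j2" "2 * i2 + 7 * j2 \<le> 2 * b" and
    3: "i3 \<le> 3" "gtype E C {x, y, v} i3 j3" "2 * i3 + 7 * j3 \<le> 2 * c"
    by blast
  have "node_ok E (A \<union> B \<union> C) {x, y, z} (i1 + i2 + i3) (j1 + j2 + j3)"
    by (rule node_ok_gtype[OF insert.hyps(1-7) 1(2) 2(2) 3(2) 1(1) 2(1) 3(1)])
  then obtain i j k where "i \<le> 3" "gtype E (A \<union> B \<union> C) {x, y, z} i (j1 + j2 + j3 + j)"
    "2 * i + 7 * j \<le> 2 * (i1 + i2 + i3) + 2"
    "guardable E (Set.insert {x, y, z} (A \<union> B \<union> C)) {} {} (j1 + j2 + j3 + k)"
    "7 * k \<le> 2 * (i1 + i2 + i3) + 8"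
    unfolding node_ok_def by blast
  moreover from this(3) 1(3) 2(3) 3(3) have
    "2 * i + 7 * (j1 + j2 + j3 + j) \<le> 2 * Suc (a + b + c)"
    by (simp add: algebra_simps)
  moreover from calculation(5) 1(3) 2(3) 3(3) have
    "7 * (j1 + j2 + j3 + k) \<le> 2 * Suc (a + b + c) + 6"
    by (simp add: algebra_simps)
  ultimately show ?case by blast
qed

text \<open>Only an inclusion of faces is claimed: the recursion is carried out in one of the three parts,
  and other parts might contain the face \<open>f\<close> as well.\<close>

lemma stacking_insert:
  assumes "stacking E F K n" "f \<in> F" "f = {x, y, z}" "distinct [v, x, y, z]"
    "{v, x} \<in> E" "{v, y} \<in> E" "{v, z} \<in> E" "{x, y} \<in> E" "{y, z} \<in> E" "{x, z} \<in> E"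
  shows "\<exists>F'. stacking E F' K (Suc n) \<and> (F - {f}) \<union> {{v, y, z}, {x, v, z}, {x, y, v}} \<subseteq> F'"
  using assms(1,2)
proof induction
  case (face K)
  have "stacking E ({{v, y, z}} \<union> {{x, v, z}} \<union> {{x, y, v}}) {x, y, z} (Suc (0 + 0 + 0))"
    by (rule stacking.insert[OF assms(4-10) stacking.face stacking.face stacking.face])
  moreover have "K = {x, y, z}" using face assms(3) by simp
  ultimately show ?case using assms(3) by (intro exI) auto
next
  case (insert w p q r A a B b C c)
  let ?N = "{{v, y, z}, {x, v, z}, {x, y, v}}"
  note st = stacking.insert[OF insert.hyps(1-7)]
  from insert.prems consider "f \<in> A" | "f \<in> B" | "f \<in> C" by blast
  then show ?case
  proof cases
    case 1
    then obtain F' where "stacking E F' {w, q, r} (Suc a)" "A - {f} \<union> ?N \<subseteq> F'"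
      using insert.IH(1) by blast
    then have "stacking E (F' \<union> B \<union> C) {p, q, r} (Suc (Suc a + b + c))" "A \<union> B \<union> C - {f} \<union> ?N \<subseteq> F' \<union> B \<union> C"
      using st[of F' "Suc a" B b C c] insert.hyps by auto
    then show ?thesis by (metis add_Suc)
  next
    case 2
    then obtain F' where "stacking E F' {p, w, r} (Suc b)" "B - {f} \<union> ?N \<subseteq> F'"
      using insert.IH(2) by blast
    then have "stacking E (A \<union> F' \<union> C) {p, q, r} (Suc (a + Suc b + c))" "A \<union> B \<union> C - {f} \<union> ?N \<subseteq> A \<union> F' \<union> C"
      using st[of A a F' "Suc b" C c] insert.hyps by auto
    then show ?thesis by (metis add_Suc add_Suc_right)
  next
    case 3
    then obtain F' where "stacking E F' {p, q, w} (Suc c)" "C - {f} \<union> ?N \<subseteq> F'"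
      using insert.IH(3) by blast
    then have "stacking E (A \<union> B \<union> F') {p, q, r} (Suc (a + b + Suc c))" "A \<union> B \<union> C - {f} \<union> ?N \<subseteq> A \<union> B \<union> F'"
      using st[of A a B b F' "Suc c"] insert.hyps by auto
    then show ?thesis by (metis add_Suc_right)
  qed
qed

section \<open>Subdividing the inside of a triangle\<close>

text \<open>\<open>U\<close> lies in \<open>f\<close> by maximality of components. Conversely,
  \<open>f\<close> is connected and avoids the frontier of \<open>U\<close>, so it cannot leave
  \<open>U\<close>.\<close>

lemma component_eqI:
  fixes D :: "complex set"
  assumes "f \<in> components (- D)" "connected U" "U \<inter> D = {}" "frontier U \<subseteq> D" "f \<inter> U \<noteq> {}"
  shows "f = U"
proof
  show "U \<subseteq> f"
    using components_maximal[OF assms(1,2)] assms(3,5) by blast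
  have "f \<inter> frontier U = {}"
    using in_components_subset[OF assms(1)] assms(4) by blast
  then show "f \<subseteq> U"
    using connected_Int_frontier[OF in_components_connected[OF assms(1)], of U] assms(5) by blast
qed

lemma connected_arc_minus_pathfinish:
  fixes g :: "real \<Rightarrow> 'a::t2_space"
  assumes "arc g"
  shows "connected (path_image g - {pathfinish g})"
proof -
  have "inj_on g {0..1}" using assms by (simp add: arc_def)
  then have "g t \<noteq> g 1" if "t \<in> {0..<1}" for t
    using that by (auto dest: inj_onD)
  moreover have "{0..1} = insert 1 {0..<1::real}" by auto
  ultimately have "path_image g - {pathfinish g} = g ` {0..<1}"
    unfolding path_image_def pathfinish_def by auto
  moreover have "connected (g ` {0..<1})"
    using assms unfolding arc_def path_def
    by (intro connected_continuous_image) (auto intro: continuous_on_subset convex_connected)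
  ultimately show ?thesis by simp
qed

lemma connected_arc_minus_pathstart:
  fixes g :: "real \<Rightarrow> 'a::t2_space"
  assumes "arc g"
  shows "connected (path_image g - {pathstart g})"
  using connected_arc_minus_pathfinish[OF arc_reversepath[OF assms]] by simp

text \<open>Used for the spokes: starting at the new vertex, they remain in its face up to their
  last point.\<close>

lemma arc_minus_pathfinish_subset_component:
  fixes D :: "complex set"
  assumes "arc g" "f \<in> components (- D)" "pathstart g \<in> f" "path_image g \<inter> D \<subseteq> {pathfinish g}"
  shows "path_image g - {pathfinish g} \<subseteq> f"
proof -
  have "pathstart g \<in> path_image g - {pathfinish g}"
    using arc_distinct_ends[OF assms(1)] by (simp add: pathstart_in_path_image)
  then show ?thesis
    using assms(3,4) components_maximal[OF assms(2) connected_arc_minus_pathfinish[OF assms(1)]] by blast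
qed

lemma triangle_inside:
  fixes p q r :: "real \<Rightarrow> complex"
  assumes "arc p" "arc q" "arc r"
    "pathfinish p = pathstart q" "pathfinish q = pathstart r" "pathfinish r = pathstart p"
    "path_image p \<inter> path_image q = {pathstart q}" "path_image q \<inter> path_image r = {pathstart r}"
    "path_image r \<inter> path_image p = {pathstart p}"
  defines "C \<equiv> path_image p \<union> path_image q \<union> path_image r"
  shows "open (inside C)" "connected (inside C)" "bounded (inside C)"
    "connected (outside C)" "\<not> bounded (outside C)"
    "inside C \<union> outside C = - C" "frontier (inside C) = C" "frontier (outside C) = C"
proof -
  have "arc (p +++ q)" using assms by (intro arc_join) auto
  then have "simple_path ((p +++ q) +++ r)"
    using assms by (intro simple_path_join_loop) (auto simp: path_image_join)
  moreover have "path_image ((p +++ q) +++ r) = C"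
    using assms by (simp add: path_image_join)
  ultimately show "open (inside C)" "connected (inside C)" "bounded (inside C)"
    "connected (outside C)" "\<not> bounded (outside C)"
    "inside C \<union> outside C = - C" "frontier (inside C) = C" "frontier (outside C) = C"
    using Jordan_inside_outside[of "(p +++ q) +++ r"] assms(6) by simp_all
qed

text \<open>Two theta curves: the path from \<open>x\<close> through \<open>v\<close> to
  \<open>z\<close> splits \<open>T\<close> into \<open>T\<^sub>2\<close> and \<open>?U\<close>, and
  then \<open>b\<close> splits \<open>?U\<close> into \<open>T\<^sub>1\<close> and
  \<open>T\<^sub>3\<close>.\<close>

lemma K4_inside:
  fixes p q r a b d :: "real \<Rightarrow> complex"
  assumes arcs: "arc p" "arc q" "arc r" "arc a" "arc b" "arc d"
    and ends: "pathstart p = x" "pathfinish p = y" "pathstart q = y" "pathfinish q = z"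
      "pathstart r = x" "pathfinish r = z" "pathstart a = v" "pathfinish a = x"
      "pathstart b = v" "pathfinish b = y" "pathstart d = v" "pathfinish d = z"
    and ints: "path_image p \<inter> path_image q = {y}" "path_image p \<inter> path_image r = {x}"
      "path_image q \<inter> path_image r = {z}" "path_image a \<inter> path_image b = {v}"
      "path_image a \<inter> path_image d = {v}" "path_image b \<inter> path_image d = {v}"
      "path_image p \<inter> path_image a = {x}" "path_image p \<inter> path_image b = {y}"
      "path_image p \<inter> path_image d = {}" "path_image q \<inter> path_image a = {}"
      "path_image q \<inter> path_image b = {y}" "path_image q \<inter> path_image d = {z}"
      "path_image r \<inter> path_image a = {x}" "path_image r \<inter> path_image b = {}"
      "path_image r \<inter> path_image d = {z}"
    and v: "v \<in> inside (path_image p \<union> path_image q \<union> path_image r)"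
  defines "T \<equiv> inside (path_image p \<union> path_image q \<union> path_image r)"
    and "T\<^sub>1 \<equiv> inside (path_image q \<union> path_image b \<union> path_image d)"
    and "T\<^sub>2 \<equiv> inside (path_image r \<union> path_image a \<union> path_image d)"
    and "T\<^sub>3 \<equiv> inside (path_image p \<union> path_image a \<union> path_image b)"
    and "S \<equiv> path_image a \<union> path_image b \<union> path_image d"
  shows "T \<subseteq> T\<^sub>1 \<union> T\<^sub>2 \<union> T\<^sub>3 \<union> S" "T\<^sub>1 \<union> T\<^sub>2 \<union> T\<^sub>3 \<subseteq> T - S"
proof -
  let ?U = "inside (path_image p \<union> path_image q \<union> (path_image a \<union> path_image d))"
  have ne: "x \<noteq> y" "y \<noteq> z" "x \<noteq> z" "v \<noteq> x" "v \<noteq> y" "v \<noteq> z"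
    using arcs ends arc_distinct_ends by metis+
  have ims: "x \<in> path_image p" "y \<in> path_image p" "z \<in> path_image q" "y \<in> path_image b"
    "v \<in> path_image b" "v \<in> path_image a"
    using ends pathstart_in_path_image pathfinish_in_path_image by metis+
  have im1: "path_image (p +++ q) = path_image p \<union> path_image q"
    "path_image (reversepath a +++ d) = path_image a \<union> path_image d"
    using ends by (simp_all add: path_image_join)
  have arcs1: "arc (p +++ q)" "arc (reversepath a +++ d)"
    using arcs ends ints by (auto intro!: arc_join arc_reversepath)
  have 1: "T\<^sub>2 \<inter> ?U = {} \<and> T\<^sub>2 \<union> ?U \<union> (path_image a \<union> path_image d - {x, z}) = T"
  proof (rule split_inside_simple_closed_curve[of r x z "p +++ q" "reversepath a +++ d"])
    assume "inside (path_image r \<union> path_image (reversepath a +++ d)) \<inter>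
        inside (path_image (p +++ q) \<union> path_image (reversepath a +++ d)) = {}"
      "inside (path_image r \<union> path_image (reversepath a +++ d)) \<union>
        inside (path_image (p +++ q) \<union> path_image (reversepath a +++ d)) \<union>
        (path_image (reversepath a +++ d) - {x, z}) =
        inside (path_image r \<union> path_image (p +++ q))"
    then show ?thesis unfolding im1 T_def T\<^sub>2_def by (simp add: Un_ac)
  qed (use arcs arcs1 ends ints ne v ims in \<open>auto simp: im1 arc_imp_simple_path Un_ac\<close>)
  have T: "T \<inter> (path_image p \<union> path_image q \<union> path_image r) = {}"
    unfolding T_def by (rule inside_no_overlap)
  have fT: "frontier T = path_image p \<union> path_image q \<union> path_image r"
    using triangle_inside(7)[of p q "reversepath r"] arcs ends ints
    unfolding T_def by (auto simp: arc_reversepath Int_commute)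
  have T2: "frontier T\<^sub>2 = path_image r \<union> path_image a \<union> path_image d"
    using triangle_inside(7)[of r "reversepath d" a] arcs ends ints
    unfolding T\<^sub>2_def by (auto simp: arc_reversepath Int_commute Un_ac)
  have b: "path_image b - {y} \<subseteq> T"
  proof (rule ccontr)
    assume "\<not> path_image b - {y} \<subseteq> T"
    moreover have "v \<in> (path_image b - {y}) \<inter> T"
      using ims ne v unfolding T_def by simp
    ultimately have "(path_image b - {y}) \<inter> frontier T \<noteq> {}"
      using connected_arc_minus_pathfinish[OF arcs(5)] ends(10)
      by (intro connected_Int_frontier) auto
    then show False using fT ints(8,11,14) by blast
  qed
  \<comment> \<open>The second split needs that \<open>b\<close> runs on the side of
    \<open>?U\<close>. On the side of \<open>T\<^sub>2\<close> it could not get to \<open>y\<close>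
    without crossing the frontier of \<open>T\<^sub>2\<close>.\<close>
  have 2: "path_image b \<inter> ?U \<noteq> {}"
  proof
    assume "path_image b \<inter> ?U = {}"
    then have sub: "path_image b - {y, v} \<subseteq> T\<^sub>2"
      using b 1 ints(4,6) by blast
    \<comment> \<open>The midpoint witnesses that \<open>b\<close> has a point besides its
      ends.\<close>
    have "inj_on b {0..1}" using arcs(5) by (simp add: arc_def)
    then have "b (1/2) \<noteq> b 0" "b (1/2) \<noteq> b 1"
      by (auto dest: inj_onD)
    then have "b (1/2) \<in> path_image b - {y, v}"
      using ends(9,10) unfolding path_image_def pathstart_def pathfinish_def by auto
    then have "(path_image b - {v}) \<inter> T\<^sub>2 \<noteq> {}" using sub by blast
    moreover have "y \<in> (path_image b - {v}) - T\<^sub>2"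
      using ims(2,4) ne(5) T 1 by blast
    ultimately have "(path_image b - {v}) \<inter> frontier T\<^sub>2 \<noteq> {}"
      using connected_arc_minus_pathstart[OF arcs(5)] ends(9)
      by (intro connected_Int_frontier) auto
    then show False using T2 ints(4,6,14) by blast
  qed
  have im2: "path_image (reversepath p +++ reversepath a) = path_image p \<union> path_image a"
    "path_image (q +++ reversepath d) = path_image q \<union> path_image d"
    using ends by (simp_all add: path_image_join)
  have arcs2: "arc (reversepath p +++ reversepath a)" "arc (q +++ reversepath d)"
    using arcs ends ints by (auto intro!: arc_join arc_reversepath)
  have 3: "T\<^sub>3 \<inter> T\<^sub>1 = {} \<and> T\<^sub>3 \<union> T\<^sub>1 \<union> (path_image b - {y, v}) = ?U"
  proof (rule split_inside_simple_closed_curve[of "reversepath p +++ reversepath a" y v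
        "q +++ reversepath d" "reversepath b"])
    assume "inside (path_image (reversepath p +++ reversepath a) \<union> path_image (reversepath b)) \<inter>
        inside (path_image (q +++ reversepath d) \<union> path_image (reversepath b)) = {}"
      "inside (path_image (reversepath p +++ reversepath a) \<union> path_image (reversepath b)) \<union>
        inside (path_image (q +++ reversepath d) \<union> path_image (reversepath b)) \<union>
        (path_image (reversepath b) - {y, v}) =
        inside (path_image (reversepath p +++ reversepath a) \<union> path_image (q +++ reversepath d))"
    then show ?thesis unfolding im2 T\<^sub>1_def T\<^sub>3_def by (simp add: Un_ac)
  qed (use arcs arcs2 ends ints ne 2 ims in \<open>auto simp: im2 arc_imp_simple_path arc_reversepath Un_ac\<close>)
  have sub: "T\<^sub>2 \<subseteq> T" "?U \<subseteq> T" "T \<subseteq> T\<^sub>2 \<union> ?U \<union> (path_image a \<union> path_image d)" "T\<^sub>2 \<inter> ?U = {}"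
    using 1 by blast+
  have sub': "T\<^sub>1 \<subseteq> ?U" "T\<^sub>3 \<subseteq> ?U" "?U \<subseteq> T\<^sub>1 \<union> T\<^sub>3 \<union> path_image b" "path_image b \<subseteq> insert y (insert v ?U)"
    using 3 by blast+
  have no: "T\<^sub>1 \<inter> (path_image q \<union> path_image b \<union> path_image d) = {}"
    "T\<^sub>2 \<inter> (path_image r \<union> path_image a \<union> path_image d) = {}"
    "T\<^sub>3 \<inter> (path_image p \<union> path_image a \<union> path_image b) = {}"
    "?U \<inter> (path_image p \<union> path_image q \<union> (path_image a \<union> path_image d)) = {}"
    unfolding T\<^sub>1_def T\<^sub>2_def T\<^sub>3_def by (rule inside_no_overlap)+
  show "T \<subseteq> T\<^sub>1 \<union> T\<^sub>2 \<union> T\<^sub>3 \<union> S"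
    using sub(3) sub'(3) unfolding S_def by blast
  have "y \<notin> T\<^sub>2" "v \<notin> T\<^sub>2"
    using T sub(1) no(2) ims(2,6) by blast+
  then have "T\<^sub>2 \<inter> path_image b = {}"
    using sub(4) sub'(4) by blast
  then have "T\<^sub>2 \<inter> S = {}" using no(2) unfolding S_def by blast
  moreover have "T\<^sub>1 \<inter> S = {}" using no(1,4) sub'(1) unfolding S_def by blast
  moreover have "T\<^sub>3 \<inter> S = {}" using no(3,4) sub'(2) unfolding S_def by blast
  ultimately show "T\<^sub>1 \<union> T\<^sub>2 \<union> T\<^sub>3 \<subseteq> T - S"
    using sub(1,2) sub'(1,2) by blast
qed

text \<open>A face is specified by its frontier only. The outside of \<open>C\<close> is connected
  and avoids this frontier, so if it met \<open>f\<close>, it would lie in \<open>f\<close>, which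
  is bounded. Hence \<open>f\<close> lies inside, and by connectedness fills the inside.\<close>

lemma bounded_component_eq_inside:
  fixes D :: "complex set"
  assumes "closed D" "f \<in> components (- D)" "bounded f" "frontier f = C"
    and C: "connected (inside C)" "connected (outside C)" "\<not> bounded (outside C)"
      "inside C \<union> outside C = - C" "frontier (inside C) = C"
  shows "f = inside C"
proof -
  have "open f" using open_components[of "- D" f] assms(1,2) by (simp add: open_Compl)
  then have fC: "f \<inter> C = {}"
    using assms(4) by (simp add: frontier_def interior_open Diff_Int_distrib) blast
  have "f \<noteq> {}" "connected f"
    using assms(2) in_components_nonempty in_components_connected by blast+
  have "\<not> outside C \<subseteq> f" using assms(3) C(3) bounded_subset by blast
  moreover have "outside C \<inter> C = {}" using outside_no_overlap[of C] by blast
  ultimately have "outside C \<inter> f = {}"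
    using connected_Int_frontier[OF C(2), of f] assms(4) by blast
  then have "f \<inter> inside C \<noteq> {}" "f \<subseteq> inside C"
    using fC C(4) \<open>f \<noteq> {}\<close> by blast+
  moreover have "inside C \<inter> C = {}" using inside_no_overlap[of C] by blast
  ultimately have "inside C \<subseteq> f"
    using connected_Int_frontier[OF C(1), of f] assms(4) by blast
  with \<open>f \<subseteq> inside C\<close> show ?thesis by simp
qed

section \<open>Faces of plane graphs\<close>

locale plane =
  fixes G :: "'v drawn_graph"
  assumes plane: "plane_graph G"
begin

lemma finite_verts: "finite (verts G)"
  using plane unfolding plane_graph_def simple_graph_def by simp

lemma edgeD: "e \<in> edges G \<Longrightarrow> e \<subseteq> verts G" "e \<in> edges G \<Longrightarrow> card e = 2"
  using plane unfolding plane_graph_def simple_graph_def by auto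

lemma inj_point: "inj_on (point G) (verts G)"
  using plane unfolding plane_graph_def crossing_free_embedding_def by simp

lemma finite_edges: "finite (edges G)"
  using finite_subset[of "edges G" "Pow (verts G)"] finite_verts edgeD(1) by blast

text \<open>An edge is an unordered pair, so its curve may run either way; here a direction is
  fixed.\<close>

lemma edge_arc:
  assumes "{u, w} \<in> edges G"
  obtains g where "arc g" "pathstart g = point G u" "pathfinish g = point G w"
    "path_image g = path_image (curve G {u, w})"
proof -
  let ?c = "curve G {u, w}"
  have c: "arc ?c" "{pathstart ?c, pathfinish ?c} = {point G u, point G w}"
    using plane assms unfolding plane_graph_def crossing_free_embedding_def by auto
  show ?thesis
  proof (cases "pathstart ?c = point G u")
    case True
    then show ?thesis using c that[of ?c] by (auto simp: doubleton_eq_iff)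
  next
    case False
    then show ?thesis using c that[of "reversepath ?c"]
      by (auto simp: doubleton_eq_iff arc_reversepath)
  qed
qed

lemma point_in_edge: "e \<in> edges G \<Longrightarrow> point G ` e \<subseteq> path_image (curve G e)"
  using plane pathstart_in_path_image[of "curve G e"] pathfinish_in_path_image[of "curve G e"]
  unfolding plane_graph_def crossing_free_embedding_def by (metis empty_subsetI insert_subset)

lemma point_in_edgeD:
  "e \<in> edges G \<Longrightarrow> u \<in> verts G \<Longrightarrow> point G u \<in> path_image (curve G e) \<Longrightarrow> u \<in> e"
  using plane unfolding plane_graph_def crossing_free_embedding_def by blast

lemma edge_Int:
  assumes "e \<in> edges G" "e' \<in> edges G" "e \<noteq> e'"
  shows "path_image (curve G e) \<inter> path_image (curve G e') = point G ` (e \<inter> e')"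
proof
  show "path_image (curve G e) \<inter> path_image (curve G e') \<subseteq> point G ` (e \<inter> e')"
    using plane assms unfolding plane_graph_def crossing_free_embedding_def by blast
  show "point G ` (e \<inter> e') \<subseteq> path_image (curve G e) \<inter> path_image (curve G e')"
    using point_in_edge[OF assms(1)] point_in_edge[OF assms(2)] by blast
qed

lemma closed_edge: "e \<in> edges G \<Longrightarrow> closed (path_image (curve G e))"
  using plane unfolding plane_graph_def crossing_free_embedding_def
  by (simp add: closed_arc_image)

lemma closed_drawing: "closed (drawing G)"
  unfolding drawing_def using finite_verts finite_edges closed_edge
  by (intro closed_Un closed_UN finite_imp_closed) auto

abbreviation tri :: "'v \<Rightarrow> 'v \<Rightarrow> 'v \<Rightarrow> complex set" where
  "tri x y z \<equiv> path_image (curve G {x, y}) \<union> path_image (curve G {y, z}) \<union> path_image (curve G {x, z})"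

lemma tri_inside:
  assumes "distinct [x, y, z]" "{x, y} \<in> edges G" "{y, z} \<in> edges G" "{x, z} \<in> edges G"
  shows "connected (inside (tri x y z))" "bounded (inside (tri x y z))"
    "connected (outside (tri x y z))" "\<not> bounded (outside (tri x y z))"
    "inside (tri x y z) \<union> outside (tri x y z) = - tri x y z"
    "frontier (inside (tri x y z)) = tri x y z" "frontier (outside (tri x y z)) = tri x y z"
proof -
  obtain p where p: "arc p" "pathstart p = point G x" "pathfinish p = point G y"
    "path_image p = path_image (curve G {x, y})" using edge_arc[OF assms(2)] by blast
  obtain q where q: "arc q" "pathstart q = point G y" "pathfinish q = point G z"
    "path_image q = path_image (curve G {y, z})" using edge_arc[OF assms(3)] by blast
  obtain r where r: "arc r" "pathstart r = point G z" "pathfinish r = point G x"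
    "path_image r = path_image (curve G {x, z})"
    using edge_arc[of z x] assms(4) by (metis insert_commute)
  have "path_image p \<inter> path_image q = {point G y}" "path_image q \<inter> path_image r = {point G z}"
    "path_image r \<inter> path_image p = {point G x}"
    using edge_Int[OF assms(2,3)] edge_Int[OF assms(3,4)] edge_Int[OF assms(4,2)] assms(1) p(4) q(4) r(4)
    by (auto simp: doubleton_eq_iff)
  then have *: "path_image p \<inter> path_image q = {pathstart q}"
    "path_image q \<inter> path_image r = {pathstart r}" "path_image r \<inter> path_image p = {pathstart p}"
    using p q r by auto
  show "connected (inside (tri x y z))" "bounded (inside (tri x y z))"
    "connected (outside (tri x y z))" "\<not> bounded (outside (tri x y z))"
    "inside (tri x y z) \<union> outside (tri x y z) = - tri x y z"
    "frontier (inside (tri x y z)) = tri x y z" "frontier (outside (tri x y z)) = tri x y z"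
    using triangle_inside[OF p(1) q(1) r(1) _ _ _ *] p q r by simp_all
qed

lemma bounded_face_eq_inside:
  assumes "f \<in> faces G" "bounded f" "bounded_by_triangle G f x y z"
  shows "f = inside (tri x y z)"
proof (rule bounded_component_eq_inside[OF closed_drawing])
  show "f \<in> components (- drawing G)" using assms(1) unfolding faces_def .
  show "frontier f = tri x y z" using assms(3) unfolding bounded_by_triangle_def by simp
qed (use assms tri_inside[of x y z] in \<open>auto simp: bounded_by_triangle_def\<close>)

text \<open>The corners can be recovered from the face, so two descriptions of it differ only in
  their order.\<close>

lemma bounded_by_triangle_verts:
  assumes "bounded_by_triangle G f x y z"
  shows "{u \<in> verts G. point G u \<in> frontier f} = {x, y, z}"
proof
  have e: "{x, y} \<in> edges G" "{y, z} \<in> edges G" "{x, z} \<in> edges G"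
    and f: "frontier f = tri x y z"
    using assms unfolding bounded_by_triangle_def by auto
  show "{u \<in> verts G. point G u \<in> frontier f} \<subseteq> {x, y, z}"
    using point_in_edgeD[OF e(1)] point_in_edgeD[OF e(2)] point_in_edgeD[OF e(3)] f by blast
  show "{x, y, z} \<subseteq> {u \<in> verts G. point G u \<in> frontier f}"
    using edgeD(1)[OF e(1)] edgeD(1)[OF e(2)] point_in_edge[OF e(1)] point_in_edge[OF e(2)] f by auto
qed

end

definition triangulated_by :: "'v drawn_graph \<Rightarrow> 'v set set \<Rightarrow> 'v set \<Rightarrow> bool" where
  "triangulated_by G F K \<longleftrightarrow> (\<forall>f\<in>faces G.
     (bounded f \<longrightarrow> (\<exists>a b c. {a, b, c} \<in> F \<and> bounded_by_triangle G f a b c)) \<and>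
     (\<not> bounded f \<longrightarrow> point G ` K \<subseteq> frontier f))"

lemma triangle_triangulated_by:
  assumes "plane_graph G" "distinct [x, y, z]" "verts G = {x, y, z}"
    "edges G = {{x, y}, {y, z}, {x, z}}"
  shows "triangulated_by G {{x, y, z}} {x, y, z}"
  unfolding triangulated_by_def
proof
  interpret plane G by unfold_locales (fact assms(1))
  have e: "{x, y} \<in> edges G" "{y, z} \<in> edges G" "{x, z} \<in> edges G" using assms(4) by auto
  note tri = tri_inside[OF assms(2) e]
  have D: "drawing G = tri x y z"
    using assms(3,4) point_in_edge[OF e(1)] point_in_edge[OF e(2)] unfolding drawing_def by auto
  fix f assume f: "f \<in> faces G"
  then have fD: "f \<in> components (- drawing G)" unfolding faces_def .
  have "f \<noteq> {}" "f \<subseteq> - tri x y z"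
    using fD D in_components_nonempty in_components_subset by blast+
  then have "f \<inter> inside (tri x y z) \<noteq> {} \<or> f \<inter> outside (tri x y z) \<noteq> {}"
    using tri(5) by blast
  moreover have "f = inside (tri x y z)" if "f \<inter> inside (tri x y z) \<noteq> {}"
    by (rule component_eqI[OF fD]) (use tri that D inside_no_overlap[of "tri x y z"] in auto)
  moreover have "f = outside (tri x y z)" if "f \<inter> outside (tri x y z) \<noteq> {}"
    by (rule component_eqI[OF fD]) (use tri that D outside_no_overlap[of "tri x y z"] in auto)
  ultimately consider "f = inside (tri x y z)" | "f = outside (tri x y z)" by blast
  then show "(bounded f \<longrightarrow> (\<exists>a b c. {a, b, c} \<in> {{x, y, z}} \<and> bounded_by_triangle G f a b c)) \<and>
     (\<not> bounded f \<longrightarrow> point G ` {x, y, z} \<subseteq> frontier f)"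
  proof cases
    case 1
    then have "bounded_by_triangle G f x y z"
      using e tri assms(2) unfolding bounded_by_triangle_def by simp
    then show ?thesis using 1 tri(2) by blast
  next
    case 2
    then have "point G ` {x, y, z} \<subseteq> frontier f"
      using tri(7) point_in_edge[OF e(1)] point_in_edge[OF e(2)] by auto
    then show ?thesis using 2 tri(4) by blast
  qed
qed

text \<open>A side is the triple without one corner, so the sides depend only on the set of
  corners.\<close>

lemma triple_pairs_eq:
  assumes "{s, t, u} = {x, y, z}" "distinct [s, t, u]" "distinct [x, y, z]"
  shows "{{s, t}, {t, u}, {s, u}} = {{x, y}, {y, z}, {x, z}}"
proof -
  have *: "{{a, b}, {b, c}, {a, c}} = (\<lambda>w. {a, b, c} - {w}) ` {a, b, c}" if "distinct [a, b, c]" for a b c :: 'a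
  proof -
    have "{a, b, c} - {a} = {b, c}" "{a, b, c} - {b} = {a, c}" "{a, b, c} - {c} = {a, b}"
      using that by auto
    then show ?thesis by (simp only: image_insert image_empty) auto
  qed
  show ?thesis unfolding *[OF assms(2)] *[OF assms(3)] assms(1) ..
qed

text \<open>Every face of \<open>H\<close> lies in a face \<open>g\<close> of \<open>G\<close>. If
  \<open>g = f\<close>, it is one of the three insides from \<open>K4_inside\<close>. Otherwise no
  spoke enters \<open>g\<close>, so \<open>g\<close> is itself the face of \<open>H\<close>.\<close>

lemma stack_triangulated_by:
  assumes G: "plane_graph G" and T: "triangulated_by G F K" and K: "K \<subseteq> verts G"
    and f: "f \<in> inner_faces G" and xyz: "bounded_by_triangle G f x y z"
    and v: "v \<notin> verts G" and H: "plane_graph H"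
    and vH: "verts H = insert v (verts G)"
    and eH: "edges H = edges G \<union> {{v, x}, {v, y}, {v, z}}"
    and pH: "\<forall>u\<in>verts G. point H u = point G u"
    and cH: "\<forall>e\<in>edges G. curve H e = curve G e"
    and pv: "point H v \<in> f"
    and F': "(F - {{x, y, z}}) \<union> {{v, y, z}, {x, v, z}, {x, y, v}} \<subseteq> F'"
  shows "triangulated_by H F' K"
  unfolding triangulated_by_def
proof
  interpret G: plane G by unfold_locales (fact G)
  interpret H: plane H by unfold_locales (fact H)
  let ?I = "\<lambda>u w. path_image (curve H {u, w})"
  have fG: "f \<in> faces G" "bounded f" using f unfolding inner_faces_def by auto
  have F1: "F - {{x, y, z}} \<subseteq> F'" "{v, y, z} \<in> F'" "{x, v, z} \<in> F'" "{x, y, v} \<in> F'"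
    using F' by simp_all
  have eG: "{x, y} \<in> edges G" "{y, z} \<in> edges G" "{x, z} \<in> edges G"
    and d3: "distinct [x, y, z]"
    using xyz unfolding bounded_by_triangle_def by auto
  have xyzV: "x \<in> verts G" "y \<in> verts G" "z \<in> verts G"
    using G.edgeD(1)[OF eG(1)] G.edgeD(1)[OF eG(2)] by auto
  have dist: "distinct [v, x, y, z]" using d3 xyzV v by auto
  have e: "{x, y} \<in> edges H" "{y, z} \<in> edges H" "{x, z} \<in> edges H"
    "{v, x} \<in> edges H" "{v, y} \<in> edges H" "{v, z} \<in> edges H"
    using eG eH by auto
  have I: "?I x y = path_image (curve G {x, y})" "?I y z = path_image (curve G {y, z})"
    "?I x z = path_image (curve G {x, z})"
    using cH eG by auto
  have fin: "f = inside (?I x y \<union> ?I y z \<union> ?I x z)"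
    using G.bounded_face_eq_inside[OF fG xyz] I by simp
  have fD: "f \<in> components (- drawing G)" using fG(1) unfolding faces_def .
  let ?S = "?I v x \<union> ?I v y \<union> ?I v z"
  have DG: "drawing G = point H ` verts G \<union> (\<Union>e\<in>edges G. path_image (curve H e))"
    using pH cH unfolding drawing_def by auto
  have DH: "drawing H = drawing G \<union> ?S"
    using H.point_in_edge[OF e(4)] unfolding DG unfolding drawing_def vH eH by auto
  have spoke: "?I v u - {point H u} \<subseteq> f" if u: "u \<in> {x, y, z}" for u
  proof -
    have vu: "{v, u} \<in> edges H" using u e by auto
    obtain g where g: "arc g" "pathstart g = point H v" "pathfinish g = point H u" "path_image g = ?I v u"
      using H.edge_arc[OF vu] by blast
    have "?I v u \<inter> path_image (curve H e') \<subseteq> {point H u}" if "e' \<in> edges G" for e'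
    proof -
      have "v \<notin> e'" using G.edgeD(1)[OF that] v by auto
      then have "{v, u} \<noteq> e'" "{v, u} \<inter> e' \<subseteq> {u}" by auto
      then show ?thesis using H.edge_Int[OF vu, of e'] that eH by auto
    qed
    moreover have "?I v u \<inter> point H ` verts G \<subseteq> {point H u}"
      using H.point_in_edgeD[OF vu] vH v by auto
    ultimately have "path_image g \<inter> drawing G \<subseteq> {pathfinish g}"
      unfolding DG g(3,4) by blast
    from arc_minus_pathfinish_subset_component[OF g(1) fD _ this] show ?thesis
      using g(2-4) pv by simp
  qed
  obtain p where p: "arc p" "pathstart p = point H x" "pathfinish p = point H y" "path_image p = ?I x y"
    using H.edge_arc[OF e(1)] by blast
  obtain q where q: "arc q" "pathstart q = point H y" "pathfinish q = point H z" "path_image q = ?I y z"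
    using H.edge_arc[OF e(2)] by blast
  obtain r where r: "arc r" "pathstart r = point H x" "pathfinish r = point H z" "path_image r = ?I x z"
    using H.edge_arc[OF e(3)] by blast
  obtain a where a: "arc a" "pathstart a = point H v" "pathfinish a = point H x" "path_image a = ?I v x"
    using H.edge_arc[OF e(4)] by blast
  obtain b where b: "arc b" "pathstart b = point H v" "pathfinish b = point H y" "path_image b = ?I v y"
    using H.edge_arc[OF e(5)] by blast
  obtain d where d: "arc d" "pathstart d = point H v" "pathfinish d = point H z" "path_image d = ?I v z"
    using H.edge_arc[OF e(6)] by blast
  have Int: "?I s t \<inter> ?I s' t' = point H ` ({s, t} \<inter> {s', t'})"
    if "{s, t} \<in> edges H" "{s', t'} \<in> edges H" "{s, t} \<noteq> {s', t'}" for s t s' t'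
    using H.edge_Int that by blast
  have ints: "path_image p \<inter> path_image q = {point H y}" "path_image p \<inter> path_image r = {point H x}"
      "path_image q \<inter> path_image r = {point H z}" "path_image a \<inter> path_image b = {point H v}"
      "path_image a \<inter> path_image d = {point H v}" "path_image b \<inter> path_image d = {point H v}"
      "path_image p \<inter> path_image a = {point H x}" "path_image p \<inter> path_image b = {point H y}"
      "path_image p \<inter> path_image d = {}" "path_image q \<inter> path_image a = {}"
      "path_image q \<inter> path_image b = {point H y}" "path_image q \<inter> path_image d = {point H z}"
      "path_image r \<inter> path_image a = {point H x}" "path_image r \<inter> path_image b = {}"
      "path_image r \<inter> path_image d = {point H z}"
    unfolding p(4) q(4) r(4) a(4) b(4) d(4)
    by (subst Int; use e dist in \<open>auto simp: doubleton_eq_iff\<close>)+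
  define T\<^sub>1 where "T\<^sub>1 = inside (H.tri v y z)"
  define T\<^sub>2 where "T\<^sub>2 = inside (H.tri x v z)"
  define T\<^sub>3 where "T\<^sub>3 = inside (H.tri x y v)"
  have tri: "H.tri v y z = path_image q \<union> path_image b \<union> path_image d"
    "H.tri x v z = path_image r \<union> path_image a \<union> path_image d"
    "H.tri x y v = path_image p \<union> path_image a \<union> path_image b"
    unfolding p(4) q(4) r(4) a(4) b(4) d(4) by (auto simp: insert_commute)
  have K4: "f \<subseteq> T\<^sub>1 \<union> T\<^sub>2 \<union> T\<^sub>3 \<union> ?S" "T\<^sub>1 \<union> T\<^sub>2 \<union> T\<^sub>3 \<subseteq> f - ?S"
    using K4_inside[OF p(1) q(1) r(1) a(1) b(1) d(1) p(2,3) q(2,3) r(2,3) a(2,3) b(2,3) d(2,3) ints]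
      pv fin unfolding T\<^sub>1_def T\<^sub>2_def T\<^sub>3_def tri p(4) q(4) r(4) a(4) b(4) d(4) by simp_all
  fix f' assume f': "f' \<in> faces H"
  then have f'D: "f' \<in> components (- drawing H)" unfolding faces_def .
  then have "f' \<noteq> {}" "connected f'" "f' \<subseteq> - drawing H"
    using in_components_nonempty in_components_connected in_components_subset by blast+
  moreover from this have "f' \<subseteq> - drawing G" using DH by blast
  ultimately obtain g where g: "g \<in> components (- drawing G)" "f' \<subseteq> g"
    using exists_component_superset[of f' "- drawing G"] by auto
  show "(bounded f' \<longrightarrow> (\<exists>a b c. {a, b, c} \<in> F' \<and> bounded_by_triangle H f' a b c)) \<and>
     (\<not> bounded f' \<longrightarrow> point H ` K \<subseteq> frontier f')"
  proof (cases "g = f")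
    case True
    have in_T: "\<exists>a b c. {a, b, c} \<in> F' \<and> bounded_by_triangle H f' a b c"
      if t: "distinct [s, t, u]" "{s, t} \<in> edges H" "{t, u} \<in> edges H" "{s, u} \<in> edges H"
        "{s, t, u} \<in> F'" "f' \<inter> inside (H.tri s t u) \<noteq> {}" "inside (H.tri s t u) \<subseteq> f - ?S" for s t u
    proof -
      have "H.tri s t u \<subseteq> drawing H" using t(2-4) unfolding drawing_def by blast
      moreover have "inside (H.tri s t u) \<inter> drawing H = {}"
        using t(7) in_components_subset[OF fD] DH by blast
      ultimately have "f' = inside (H.tri s t u)"
        using component_eqI[OF f'D] H.tri_inside[OF t(1-4)] t(6) by simp
      then show ?thesis
        using H.tri_inside[OF t(1-4)] t(1-5) unfolding bounded_by_triangle_def by fastforce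
    qed
    have "f' \<inter> ?S = {}" using in_components_subset[OF f'D] DH by blast
    then have "f' \<inter> T\<^sub>1 \<noteq> {} \<or> f' \<inter> T\<^sub>2 \<noteq> {} \<or> f' \<inter> T\<^sub>3 \<noteq> {}"
      using K4(1) g(2) \<open>f' \<noteq> {}\<close> unfolding True by blast
    then have "\<exists>a b c. {a, b, c} \<in> F' \<and> bounded_by_triangle H f' a b c"
    proof (elim disjE)
      assume "f' \<inter> T\<^sub>1 \<noteq> {}"
      then show ?thesis
        by (intro in_T[of v y z]) (use K4(2) e dist F1 in \<open>auto simp: T\<^sub>1_def\<close>)
    next
      assume "f' \<inter> T\<^sub>2 \<noteq> {}"
      moreover have "{x, v} \<in> edges H" using e(4) by (simp add: insert_commute)
      ultimately show ?thesis
        by (intro in_T[of x v z]) (use K4(2) e dist F1 in \<open>auto simp: T\<^sub>2_def\<close>)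
    next
      assume "f' \<inter> T\<^sub>3 \<noteq> {}"
      moreover have "{x, v} \<in> edges H" "{y, v} \<in> edges H" using e(4,5) by (simp_all add: insert_commute)
      ultimately show ?thesis
        by (intro in_T[of x y v]) (use K4(2) e dist F1 in \<open>auto simp: T\<^sub>3_def\<close>)
    qed
    moreover have "bounded f'" using fG(2) g(2) unfolding True by (rule bounded_subset)
    ultimately show ?thesis by simp
  next
    case False
    then have "g \<inter> f = {}" using components_eq[OF g(1) fD] by blast
    have "?S \<subseteq> f \<union> point H ` verts G" using spoke[of x] spoke[of y] spoke[of z] xyzV by blast
    moreover have "g \<inter> point H ` verts G = {}" using in_components_subset[OF g(1)] DG by blast
    ultimately have "g \<inter> drawing H = {}"
      using \<open>g \<inter> f = {}\<close> in_components_subset[OF g(1)] DH by blast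
    moreover have "frontier g \<subseteq> drawing H"
      using frontier_of_components_closed_complement[OF G.closed_drawing g(1)] DH by blast
    ultimately have eq: "f' = g"
      using g(2) \<open>f' \<noteq> {}\<close> by (intro component_eqI[OF f'D in_components_connected[OF g(1)]]) auto
    have f'G: "f' \<in> faces G" "f' \<noteq> f"
      unfolding eq faces_def by (fact g(1), fact False)
    have "\<exists>a b c. {a, b, c} \<in> F' \<and> bounded_by_triangle H f' a b c" if "bounded f'"
    proof -
      have "\<exists>s t u. {s, t, u} \<in> F \<and> bounded_by_triangle G f' s t u"
        using T f'G(1) that unfolding triangulated_by_def by simp
      then obtain s t u where stu: "{s, t, u} \<in> F" "bounded_by_triangle G f' s t u"
        by (elim exE conjE)
      have dstu: "distinct [s, t, u]" using stu(2) unfolding bounded_by_triangle_def by simp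
      have "f = inside (G.tri x y z)" by (rule G.bounded_face_eq_inside[OF fG xyz])
      moreover have "f' = inside (G.tri s t u)"
        by (rule G.bounded_face_eq_inside[OF f'G(1) that stu(2)])
      ultimately have ne: "G.tri s t u \<noteq> G.tri x y z" using f'G(2) by metis
      \<comment> \<open>This is why \<open>xyz\<close> may be dropped from \<open>F\<close>: a
        second bounded face with these corners would be the inside of the same closed curve as
        \<open>f\<close>.\<close>
      have "{s, t, u} \<noteq> {x, y, z}"
      proof
        assume "{s, t, u} = {x, y, z}"
        then have "{{s, t}, {t, u}, {s, u}} = {{x, y}, {y, z}, {x, z}}"
          by (rule triple_pairs_eq[OF _ dstu d3])
        moreover have tri: "G.tri i j k = (\<Union>e\<in>{{i, j}, {j, k}, {i, k}}. path_image (curve G e))" for i j k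
          by (simp add: Un_assoc)
        ultimately have "G.tri s t u = G.tri x y z" by (simp only: tri)
        then show False using ne by contradiction
      qed
      then have "{s, t, u} \<in> F'" using F1(1) stu(1) by (simp add: subset_iff)
      moreover have "bounded_by_triangle H f' s t u"
        using stu(2) cH eH unfolding bounded_by_triangle_def by simp
      ultimately show ?thesis by blast
    qed
    moreover have "point H ` K \<subseteq> frontier f'" if "\<not> bounded f'"
    proof -
      have "point H ` K = point G ` K" using pH K by (intro image_cong) auto
      then show ?thesis using T f'G(1) that unfolding triangulated_by_def by simp
    qed
    ultimately show ?thesis by simp
  qed
qed

lemma stacked_triangulation_stacking:
  assumes "stacked_triangulation G"
  shows "plane_graph G \<and> (\<exists>F K m. stacking (edges G) F K m \<and> K \<subseteq> verts G \<and>
    card (verts G) = m + 3 \<and> triangulated_by G F K)"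
  using assms
proof induction
  case (triangle G x y z)
  have "card (verts G) = 0 + 3" using triangle by simp
  then show ?case
    using triangle triangle_triangulated_by[OF triangle(1-4)] stacking.face by blast
next
  case (stack G f x y z v H)
  then obtain F K m where G: "plane_graph G" and F: "stacking (edges G) F K m" "K \<subseteq> verts G"
    "card (verts G) = m + 3" "triangulated_by G F K"
    by blast
  interpret plane G by unfold_locales (fact G)
  have xyz: "distinct [x, y, z]" "{x, y} \<in> edges G" "{y, z} \<in> edges G" "{x, z} \<in> edges G"
    using stack.hyps(3) unfolding bounded_by_triangle_def by auto
  have "x \<in> verts G" "y \<in> verts G" "z \<in> verts G"
    using edgeD(1)[OF xyz(2)] edgeD(1)[OF xyz(3)] by auto
  then have dist: "distinct [v, x, y, z]" using xyz(1) stack.hyps(4) by auto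
  have f: "f \<in> faces G" "bounded f" using stack.hyps(2) unfolding inner_faces_def by auto
  have "\<exists>a b c. {a, b, c} \<in> F \<and> bounded_by_triangle G f a b c"
    using F(4) f unfolding triangulated_by_def by simp
  then obtain a b c where abc: "{a, b, c} \<in> F" "bounded_by_triangle G f a b c"
    by (elim exE conjE)
  \<comment> \<open>The invariant lists the corners of \<open>f\<close> in an order of its
    own.\<close>
  then have "{x, y, z} \<in> F"
    using bounded_by_triangle_verts[OF abc(2)] bounded_by_triangle_verts[OF stack.hyps(3)] by simp
  moreover have "stacking (edges H) F K m"
    using stacking_mono[OF F(1)] stack.hyps(7) by blast
  ultimately obtain F' where F': "stacking (edges H) F' K (Suc m)"
    "(F - {{x, y, z}}) \<union> {{v, y, z}, {x, v, z}, {x, y, v}} \<subseteq> F'"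
    using stacking_insert[of "edges H" F K m "{x, y, z}" x y z v] dist xyz stack.hyps(7) by auto
  have "triangulated_by H F' K"
    by (rule stack_triangulated_by[OF G F(4,2) stack.hyps(2-10) F'(2)])
  moreover have "card (verts H) = Suc m + 3"
    using stack.hyps(4,6) F(3) finite_verts by simp
  moreover have "K \<subseteq> verts H" using F(2) stack.hyps(6) by auto
  ultimately show ?case using F'(1) stack.hyps(5) by blast
qed

section \<open>From guarded triangles to an edge guard set\<close>

theorem theorem5:
  fixes G :: "'v drawn_graph" and n :: nat
  assumes "stacked_triangulation G"
    and "card (verts G) = n"
    and "n \<ge> 4"
  shows "\<exists>\<Gamma>. edge_guard_set G \<Gamma> \<and> int (card \<Gamma>) \<le> \<lfloor>2 * real n / 7\<rfloor>"
proof -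
  obtain F K m where G: "plane_graph G" and F: "stacking (edges G) F K m" "K \<subseteq> verts G"
    "n = m + 3" "triangulated_by G F K"
    using stacked_triangulation_stacking[OF assms(1)] assms(2) by blast
  interpret plane G by unfold_locales (fact G)
  \<comment> \<open>A bare triangle needs an edge, but 2 * 3 < 7.\<close>
  have "m > 0" using F(3) assms(3) by simp
  then obtain k where k: "guardable (edges G) (insert K F) {} {} k" "7 * k \<le> 2 * n"
    using stacking_gtype[OF F(1)] F(3) by auto
  obtain \<Gamma> where \<Gamma>: "\<Gamma> \<subseteq> edges G" "card \<Gamma> \<le> k" "\<forall>t\<in>insert K F. t \<inter> ({} \<union> \<Union>\<Gamma>) \<noteq> {}"
    using k(1) by (rule guardableE)
  have "\<exists>e\<in>\<Gamma>. guards G e f" if "f \<in> faces G" for f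
  proof -
    have "\<exists>t\<in>insert K F. point G ` t \<subseteq> frontier f"
    proof (cases "bounded f")
      case True
      then have "\<exists>a b c. {a, b, c} \<in> F \<and> bounded_by_triangle G f a b c"
        using F(4) that unfolding triangulated_by_def by simp
      then obtain a b c where "{a, b, c} \<in> F" "bounded_by_triangle G f a b c"
        by (elim exE conjE)
      then show ?thesis using bounded_by_triangle_verts[of f a b c] by blast
    next
      case False
      then have "point G ` K \<subseteq> frontier f" using F(4) that unfolding triangulated_by_def by simp
      then show ?thesis by simp
    qed
    then obtain t where t: "t \<in> insert K F" "point G ` t \<subseteq> frontier f" by blast
    have "t \<inter> \<Union>\<Gamma> \<noteq> {}" using bspec[OF \<Gamma>(3) t(1)] by simp
    then show ?thesis using t(2) unfolding guards_def by blast
  qed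
  then have "edge_guard_set G \<Gamma>" using \<Gamma>(1) unfolding edge_guard_set_def by simp
  moreover have "int (card \<Gamma>) \<le> \<lfloor>2 * real n / 7\<rfloor>"
    using \<Gamma>(2) k(2) by (simp add: le_floor_iff)
  ultimately show ?thesis by blast
qed

end
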